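(* Let $(A_n,B_n)_{n\ge2}$, $A_n=(a_n(m,k))_{1\le m,k\le n}$, $B_n=(b_n(m,k))_{1\le m,k\le n}$, be the twin Seidel matrix sequence. Then for every $n\ge2$ and all $1\le m,k\le n$: $$a_n(m,k)=\#\{w\in \mathrm{And}_n^{I}:\ (\mathbf{F}\,w,\mathbf{NL}\,w)=(m,k)\},\qquad b_n(m,k)=\#\{w\in \mathrm{And}_n^{II}:\ (\mathbf{L}\,w,\mathbf{grn}\,w)=(m,k)\}.$$
   Context: Andr\'e permutations: words $w=x_1\cdots x_n$ are permutations of a finite set $Y$ of positive integers; the empty word and every one-letter word are Andr\'e I and Andr\'e II. For $|Y|\ge2$ write $w=v\,\min(w)\,v'$; $w$ is Andr\'e I (resp. II) if $v,v'$ are Andr\'e I (resp. II) and $\max(vv')$ (resp. $\min(vv')$) is a letter of $v'$. $\mathrm{And}_n^{I}$, $\mathrm{And}_n^{II}$: Andr\'e I, II permutations of $\{1,\dots,n\}$. $\mathbf{F}\,w=x_1$, $\mathbf{L}\,w=x_n$, $\mathbf{NL}\,w=x_{n-1}$, $\mathbf{grn}\,w=\max\{x_{i-1},x_{i+1}\}$ where $x_i=n$, with $x_0=x_{n+1}=0$. Twin Seidel matrix sequence: the unique sequence of square matrices $A_n=(a_n(m,k))$, $B_n=(b_n(m,k))$ of dimension $n$ ($n\ge2$) with nonnegative integer entries satisfying, with $a_n(m,\bullet)=\sum_k a_n(m,k)$, $a_n(\bullet,k)=\sum_m a_n(m,k)$ and similarly for $b$: (TS1) all diagonal entries of all $A_n,B_n$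 are $0$, except $a_2(1,1)=1$; (TS2) for $n\ge3$: $a_n(m,n)=b_n(m,n)=0$ for all $m$, $a_n(n,k)=b_n(1,k)=0$ for all $k$, and $b_n(n,1)=0$; (TS3) $A_2=\begin{pmatrix}1&0\\0&0\end{pmatrix}$, $B_2=\begin{pmatrix}0&0\\1&0\end{pmatrix}$; (TS4) for $n\ge3$: $b_n(n,k)=a_{n-1}(\bullet,k-1)$ for $2\le k\le n-1$; $b_n(n-1,k)=a_{n-1}(\bullet,k)$ for $1\le k\le n-2$; $b_n(m+1,k)-b_n(m,k)=a_{n-1}(m,k)$ for $2\le k+1\le m\le n-2$; $b_n(m+1,k)-b_n(m,k)=a_{n-1}(m,k-1)$ for $3\le m+2\le k\le n-1$; (TS5) for $n\ge3$: $a_n(1,k)=b_{n-1}(\bullet,k-1)$ for $2\le k\le n-1$; $a_n(m+1,k)-a_n(m,k)=-b_{n-1}(m,k-1)$ for $3\le m+2\le k\le n-1$; $a_n(m+1,k)-a_n(m,k)=-b_{n-1}(m,k)$ for $2\le k+1\le m\le n-1$. *)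

theory Defs
  imports Main "HOL-Combinatorics.Multiset_Permutations"
begin

text \<open>Andre words: words with distinct letters are
  lists, and the pivot \<open>x\<close> in \<open>v @ x # v'\<close> is the least letter of the word.\<close>

inductive andre_I :: "nat list \<Rightarrow> bool" where
  andre_I_Nil: "andre_I []"
| andre_I_single: "andre_I [x]"
| andre_I_split:
    "distinct (v @ x # v') \<Longrightarrow> v @ v' \<noteq> [] \<Longrightarrow> x = Min (set (v @ x # v')) \<Longrightarrow>
     andre_I v \<Longrightarrow> andre_I v' \<Longrightarrow> Max (set (v @ v')) \<in> set v' \<Longrightarrow> andre_I (v @ x # v')"

inductive andre_II :: "nat list \<Rightarrow> bool" where
  andre_II_Nil: "andre_II []"
| andre_II_single: "andre_II [x]"
| andre_II_split:
    "distinct (v @ x # v') \<Longrightarrow> v @ v' \<noteq> [] \<Longrightarrow> x = Min (set (v @ x # v')) \<Longrightarrow>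
     andre_II v \<Longrightarrow> andre_II v' \<Longrightarrow> Min (set (v @ v')) \<in> set v' \<Longrightarrow> andre_II (v @ x # v')"

definition And_I :: "nat \<Rightarrow> nat list set" where
  "And_I n = {w \<in> permutations_of_set {1..n}. andre_I w}"

definition And_II :: "nat \<Rightarrow> nat list set" where
  "And_II n = {w \<in> permutations_of_set {1..n}. andre_II w}"

text \<open>\<open>letter w i\<close> is the 1-based letter \<open>x\<^sub>i\<close>, extended by \<open>x\<^sub>0 = x\<^sub>n\<^sub>+\<^sub>1 = 0\<close>.\<close>

definition letter :: "nat list \<Rightarrow> nat \<Rightarrow> nat" where
  "letter w i = (if 1 \<le> i \<and> i \<le> length w then w ! (i - 1) else 0)"

definition F_stat :: "nat list \<Rightarrow> nat" where
  "F_stat w = letter w 1"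

definition L_stat :: "nat list \<Rightarrow> nat" where
  "L_stat w = letter w (length w)"

definition NL_stat :: "nat list \<Rightarrow> nat" where
  "NL_stat w = letter w (length w - 1)"

text \<open>Meant for permutations of \<open>{1..n}\<close>, where \<open>n = length w\<close> is the greatest letter and occurs
  at exactly one position.\<close>

definition grn :: "nat list \<Rightarrow> nat" where
  "grn w = (let i = (THE i. 1 \<le> i \<and> i \<le> length w \<and> letter w i = length w)
            in max (letter w (i - 1)) (letter w (i + 1)))"

text \<open>A sequence of square matrices of varying dimension is a function \<open>M\<close>, where \<open>M n m k\<close> is the
  \<open>(m, k)\<close> entry of the \<open>n\<close>-th matrix and is only meaningful for \<open>n \<ge> 2\<close> and \<open>1 \<le> m, k \<le> n\<close>.
  Differences of entries are taken in the integers, so nothing is truncated.\<close>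

type_synonym matrix_seq = "nat \<Rightarrow> nat \<Rightarrow> nat \<Rightarrow> nat"

definition col_sum :: "matrix_seq \<Rightarrow> nat \<Rightarrow> nat \<Rightarrow> nat" where
  "col_sum M n k = (\<Sum>m = 1..n. M n m k)"

definition TS1 :: "matrix_seq \<Rightarrow> matrix_seq \<Rightarrow> bool" where
  "TS1 a b \<longleftrightarrow>
     (\<forall>n\<ge>2. \<forall>m\<in>{1..n}. a n m m = (if n = 2 \<and> m = 1 then 1 else 0) \<and> b n m m = 0)"

definition TS2 :: "matrix_seq \<Rightarrow> matrix_seq \<Rightarrow> bool" where
  "TS2 a b \<longleftrightarrow>
     (\<forall>n\<ge>3. (\<forall>m\<in>{1..n}. a n m n = 0 \<and> b n m n = 0) \<and>
             (\<forall>k\<in>{1..n}. a n n k = 0 \<and> b n 1 k = 0) \<and>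
             b n n 1 = 0)"

definition TS3 :: "matrix_seq \<Rightarrow> matrix_seq \<Rightarrow> bool" where
  "TS3 a b \<longleftrightarrow>
     a 2 1 1 = 1 \<and> a 2 1 2 = 0 \<and> a 2 2 1 = 0 \<and> a 2 2 2 = 0 \<and>
     b 2 1 1 = 0 \<and> b 2 1 2 = 0 \<and> b 2 2 1 = 1 \<and> b 2 2 2 = 0"

definition TS4 :: "matrix_seq \<Rightarrow> matrix_seq \<Rightarrow> bool" where
  "TS4 a b \<longleftrightarrow>
     (\<forall>n\<ge>3.
        (\<forall>k. 2 \<le> k \<and> k \<le> n - 1 \<longrightarrow> b n n k = col_sum a (n - 1) (k - 1)) \<and>
        (\<forall>k. 1 \<le> k \<and> k \<le> n - 2 \<longrightarrow> b n (n - 1) k = col_sum a (n - 1) k) \<and>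
        (\<forall>m k. 2 \<le> k + 1 \<and> k + 1 \<le> m \<and> m \<le> n - 2 \<longrightarrow>
           int (b n (m + 1) k) - int (b n m k) = int (a (n - 1) m k)) \<and>
        (\<forall>m k. 3 \<le> m + 2 \<and> m + 2 \<le> k \<and> k \<le> n - 1 \<longrightarrow>
           int (b n (m + 1) k) - int (b n m k) = int (a (n - 1) m (k - 1))))"

definition TS5 :: "matrix_seq \<Rightarrow> matrix_seq \<Rightarrow> bool" where
  "TS5 a b \<longleftrightarrow>
     (\<forall>n\<ge>3.
        (\<forall>k. 2 \<le> k \<and> k \<le> n - 1 \<longrightarrow> a n 1 k = col_sum b (n - 1) (k - 1)) \<and>
        (\<forall>m k. 3 \<le> m + 2 \<and> m + 2 \<le> k \<and> k \<le> n - 1 \<longrightarrow>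
           int (a n (m + 1) k) - int (a n m k) = - int (b (n - 1) m (k - 1))) \<and>
        (\<forall>m k. 2 \<le> k + 1 \<and> k + 1 \<le> m \<and> m \<le> n - 1 \<longrightarrow>
           int (a n (m + 1) k) - int (a n m k) = - int (b (n - 1) m k)))"

definition twin_seidel :: "matrix_seq \<Rightarrow> matrix_seq \<Rightarrow> bool" where
  "twin_seidel a b \<longleftrightarrow> TS1 a b \<and> TS2 a b \<and> TS3 a b \<and> TS4 a b \<and> TS5 a b"

end

theory Submission
  imports Defs "HOL-Library.Infinite_Set"
begin

text \<open>A word with least letter \<open>r\<close> is a binary tree with root \<open>r\<close> whose subtrees are the words to
  the left and to the right of \<open>r\<close>. Andre I and II words are two ways of ordering the children in
  the same increasing trees with at most two children per node, and the greater neighbour of the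
  greatest letter is its parent in the tree. Splitting at the root turns the counts, as functions
  of the set of letters, into convolutions. A rotation of the subtrees hanging off the path to the
  greatest letter (\<open>last_count_rec\<close>) gives Andre II words by last letter the same recurrence as
  Andre I words by first letter. Inserting two consecutive letters \<open>x < y\<close> into a convolution by
  the Leibniz rule, all terms of the difference of two neighbouring entries cancel except those with
  \<open>x\<close> and \<open>y\<close> in the same subtree, and these are handled by induction. The relations obtained in
  this way determine the matrices.\<close>

subsection \<open>Convolution of set functions\<close>

text \<open>Product and derivative of combinatorial species, in the form of functions of the label set.\<close>

definition set_conv ::
    "('a set \<Rightarrow> 'b) \<Rightarrow> ('a set \<Rightarrow> 'b) \<Rightarrow> 'a set \<Rightarrow> 'b::comm_semiring_1" (infixl "\<star>" 70)
  where "(f \<star> g) S = (\<Sum>A\<in>Pow S. f A * g (S - A))"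

definition set_deriv :: "'a \<Rightarrow> ('a set \<Rightarrow> 'b) \<Rightarrow> 'a set \<Rightarrow> 'b" ("\<partial>")
  where "\<partial> x f A = f (insert x A)"

lemma set_deriv_commute: "\<partial> x (\<partial> y f) = \<partial> y (\<partial> x f)"
  by (simp add: set_deriv_def insert_commute fun_eq_iff)

lemma set_conv_cong:
  assumes "\<And>A. A \<subseteq> S \<Longrightarrow> f A = f' A" "\<And>A. A \<subseteq> S \<Longrightarrow> g A = g' A"
  shows "(f \<star> g) S = (f' \<star> g') S"
  unfolding set_conv_def by (intro sum.cong refl) (simp add: assms)

lemma set_conv_empty [simp]: "(f \<star> g) {} = f {} * g {}"
  by (simp add: set_conv_def)

lemma set_conv_eq_0:
  assumes "\<And>A. A \<subseteq> S \<Longrightarrow> f A = 0 \<or> g (S - A) = 0"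
  shows "(f \<star> g) S = 0"
  unfolding set_conv_def
proof (intro sum.neutral ballI)
  fix A assume "A \<in> Pow S"
  then show "f A * g (S - A) = 0" using assms[of A] by auto
qed

lemma set_conv_add_left: "((\<lambda>A. f A + g A) \<star> h) S = (f \<star> h) S + (g \<star> h) S"
  by (simp add: set_conv_def distrib_right sum.distrib)

lemma set_conv_commute: "(f \<star> g) S = (g \<star> f) S"
  unfolding set_conv_def
  by (rule sum.reindex_bij_witness[where i = "\<lambda>A. S - A" and j = "\<lambda>A. S - A"])
    (auto simp: double_diff mult.commute)

lemma set_conv_left_commute:
  assumes "finite S"
  shows "(f \<star> (g \<star> h)) S = (g \<star> (f \<star> h)) S"
proof -
  have minus_commute: "S - A - B = S - B - A" for A B by auto
  have disjoint: "Pow (S - A) = {B \<in> Pow S. A \<inter> B = {}}" for A by auto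
  have expand: "(u \<star> (v \<star> h)) S =
      (\<Sum>A\<in>Pow S. \<Sum>B\<in>{B \<in> Pow S. A \<inter> B = {}}. u A * (v B * h (S - A - B)))" for u v
    by (simp add: set_conv_def disjoint sum_distrib_left)
  have "(f \<star> (g \<star> h)) S = (\<Sum>B\<in>Pow S. \<Sum>A\<in>{A \<in> Pow S. A \<inter> B = {}}. f A * (g B * h (S - A - B)))"
    unfolding expand using assms by (intro sum.swap_restrict) auto
  also have "\<dots> = (g \<star> (f \<star> h)) S"
    unfolding expand using minus_commute by (intro sum.cong refl) (auto simp: mult.left_commute)
  finally show ?thesis .
qed

lemma set_conv_insert:
  assumes "finite S" "x \<notin> S"
  shows "(f \<star> g) (insert x S) = (\<partial> x f \<star> g) S + (f \<star> \<partial> x g) S"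
proof -
  have "Pow S \<inter> insert x ` Pow S = {}" "inj_on (insert x) (Pow S)"
    using assms(2) by (auto simp: inj_on_def)
  then have "(f \<star> g) (insert x S) = (\<Sum>A\<in>Pow S. f A * g (insert x S - A)) +
      (\<Sum>A\<in>Pow S. f (insert x A) * g (insert x S - insert x A))"
    using assms(1) by (simp add: set_conv_def Pow_insert sum.union_disjoint sum.reindex)
  moreover have "insert x S - insert x A = S - A" "insert x S - A = insert x (S - A)"
    if "A \<in> Pow S" for A
    using that assms(2) by auto
  ultimately show ?thesis
    by (simp add: set_conv_def set_deriv_def add.commute)
qed

lemma set_conv_insert_left:
  assumes "finite S" "x \<notin> S" and "\<And>A. A \<subseteq> S \<Longrightarrow> f A = 0"
  shows "(f \<star> g) (insert x S) = (\<partial> x f \<star> g) S"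
  using set_conv_insert[OF assms(1,2), of f g] set_conv_eq_0[of S f "\<partial> x g"] assms(3) by simp

lemma set_conv_concentrated_left:
  assumes "finite S" and "\<And>A. A \<subseteq> S \<Longrightarrow> A \<noteq> {} \<Longrightarrow> f A = 0"
  shows "(f \<star> g) S = f {} * g S"
proof -
  have "(f \<star> g) S = (\<Sum>A\<in>Pow S. if A = {} then f {} * g S else 0)"
    unfolding set_conv_def using assms(2) by (intro sum.cong) auto
  then show ?thesis using assms(1) by (simp add: sum.delta)
qed

text \<open>By the Leibniz rule, the terms with \<open>x\<close> and \<open>y\<close> in different factors cancel.\<close>

lemma set_conv_exchange:
  assumes S: "finite S" "x \<notin> S" "y \<notin> S" "x \<noteq> y"
    and supp: "\<And>A. A \<subseteq> insert y S \<Longrightarrow> f A = 0" "\<And>A. A \<subseteq> insert x S \<Longrightarrow> g A = 0"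
    and swap: "\<And>A. A \<subseteq> S \<Longrightarrow> \<partial> x f A = \<partial> y g A" "\<And>A. A \<subseteq> S \<Longrightarrow> \<partial> x h A = \<partial> y h A"
    and both: "\<And>A. A \<subseteq> S \<Longrightarrow> f (insert x (insert y A)) = g (insert x (insert y A)) + d A"
  shows "(f \<star> h) (insert x (insert y S)) = (g \<star> h) (insert x (insert y S)) + (d \<star> h) S"
proof -
  have "(f \<star> h) (insert x (insert y S)) = (\<partial> x f \<star> h) (insert y S)"
    using S supp(1) by (intro set_conv_insert_left) auto
  also have "\<dots> = (\<partial> y (\<partial> x f) \<star> h) S + (\<partial> x f \<star> \<partial> y h) S"
    using S by (intro set_conv_insert)
  also have "(\<partial> y (\<partial> x f) \<star> h) S = (\<partial> x (\<partial> y g) \<star> h) S + (d \<star> h) S"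
    unfolding set_conv_add_left[symmetric]
    by (intro set_conv_cong) (simp_all add: set_deriv_def both insert_commute)
  also have "(\<partial> x f \<star> \<partial> y h) S = (\<partial> y g \<star> \<partial> x h) S"
    by (intro set_conv_cong) (simp_all add: swap)
  also have "(\<partial> x (\<partial> y g) \<star> h) S + (d \<star> h) S + (\<partial> y g \<star> \<partial> x h) S =
      (\<partial> y g \<star> h) (insert x S) + (d \<star> h) S"
    using S by (simp add: set_conv_insert add_ac)
  also have "(\<partial> y g \<star> h) (insert x S) = (g \<star> h) (insert y (insert x S))"
    using S supp(2) by (intro set_conv_insert_left[symmetric]) auto
  finally show ?thesis by (simp add: insert_commute)
qed

subsection \<open>Splitting words at the least letter\<close>

inductive andre_by :: "(nat set \<Rightarrow> nat) \<Rightarrow> nat list \<Rightarrow> bool" for sel where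
  Nil: "andre_by sel []"
| single: "andre_by sel [x]"
| split: "distinct (v @ x # v') \<Longrightarrow> v @ v' \<noteq> [] \<Longrightarrow> x = Min (set (v @ x # v')) \<Longrightarrow>
     andre_by sel v \<Longrightarrow> andre_by sel v' \<Longrightarrow> sel (set (v @ v')) \<in> set v' \<Longrightarrow>
     andre_by sel (v @ x # v')"

lemma andre_I_eq: "andre_I w \<longleftrightarrow> andre_by Max w"
proof
  show "andre_I w \<Longrightarrow> andre_by Max w"
    by (induction rule: andre_I.induct) (auto intro: andre_by.intros)
  show "andre_by Max w \<Longrightarrow> andre_I w"
    by (induction rule: andre_by.induct) (auto intro: andre_I.intros)
qed

lemma andre_II_eq: "andre_II w \<longleftrightarrow> andre_by Min w"
proof
  show "andre_II w \<Longrightarrow> andre_by Min w"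
    by (induction rule: andre_II.induct) (auto intro: andre_by.intros)
  show "andre_by Min w \<Longrightarrow> andre_II w"
    by (induction rule: andre_by.induct) (auto intro: andre_II.intros)
qed

lemma andre_by_append_Cons_iff:
  assumes "distinct (v @ x # v')" "v @ v' \<noteq> []" and less: "\<And>a. a \<in> set (v @ v') \<Longrightarrow> x < a"
  shows "andre_by sel (v @ x # v') \<longleftrightarrow>
           andre_by sel v \<and> andre_by sel v' \<and> sel (set (v @ v')) \<in> set v'"
proof -
  have Min: "x = Min (set (v @ x # v'))"
    using less by (intro Min_eqI[symmetric]) (auto intro: less_imp_le)
  show ?thesis
  proof
    assume "andre_by sel (v @ x # v')"
    then show "andre_by sel v \<and> andre_by sel v' \<and> sel (set (v @ v')) \<in> set v'"
    proof cases
      case (split u y u')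
      have "x = y" using split(1,4) Min by metis
      moreover have "x \<notin> set v" "x \<notin> set v'" using assms(1) by simp_all
      ultimately have "v = u \<and> v' = u'" using split(1) append_Cons_eq_iff[of x v v' u u'] by simp
      then show ?thesis using split by simp
    qed (use assms(2) in \<open>auto simp: Cons_eq_append_conv append_eq_Cons_conv\<close>)
  next
    assume "andre_by sel v \<and> andre_by sel v' \<and> sel (set (v @ v')) \<in> set v'"
    then show "andre_by sel (v @ x # v')" using assms Min by (intro andre_by.split) auto
  qed
qed

definition andre_words :: "(nat set \<Rightarrow> nat) \<Rightarrow> nat set \<Rightarrow> nat list set" where
  "andre_words sel Y = {w. set w = Y \<and> distinct w \<and> andre_by sel w}"

definition andre_count :: "(nat set \<Rightarrow> nat) \<Rightarrow> (nat list \<Rightarrow> bool) \<Rightarrow> nat set \<Rightarrow> nat" where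
  "andre_count sel P Y = card {w \<in> andre_words sel Y. P w}"

lemma andre_count_cong:
  assumes "\<And>w. set w = Y \<Longrightarrow> distinct w \<Longrightarrow> P w \<longleftrightarrow> Q w"
  shows "andre_count sel P Y = andre_count sel Q Y"
  unfolding andre_count_def using assms
  by (auto simp: andre_words_def intro!: arg_cong[of _ _ card])

lemma andre_count_eq_0:
  assumes "\<And>w. set w = Y \<Longrightarrow> distinct w \<Longrightarrow> \<not> P w"
  shows "andre_count sel P Y = 0"
  unfolding andre_count_def using assms by (auto simp: andre_words_def card_eq_0_iff)

lemma finite_andre_words [simp]: "finite (andre_words sel Y)"
proof (cases "finite Y")
  case True
  have "andre_words sel Y \<subseteq> permutations_of_set Y"
    by (auto simp: andre_words_def permutations_of_set_def)
  then show ?thesis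
    using True finite_permutations_of_set finite_subset by blast
next
  case False
  then have "andre_words sel Y = {}"
    by (auto simp: andre_words_def)
  then show ?thesis by simp
qed

lemma andre_count_empty [simp]: "andre_count sel P {} = (if P [] then 1 else 0)"
proof -
  have "{w \<in> andre_words sel {}. P w} = (if P [] then {[]} else {})"
    by (auto simp: andre_words_def intro: andre_by.Nil)
  then show ?thesis by (simp add: andre_count_def)
qed

lemma andre_count_singleton [simp]: "andre_count sel P {x} = (if P [x] then 1 else 0)"
proof -
  have "w = [x]" if "set w = {x}" "distinct w" for w
    using that by (cases w; cases "tl w") auto
  then have "{w \<in> andre_words sel {x}. P w} = (if P [x] then {[x]} else {})"
    by (auto simp: andre_words_def intro: andre_by.single)
  then show ?thesis by (simp add: andre_count_def)
qed

lemma append_Cons_in_andre_words_iff: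
  assumes "p \<notin> T" and less: "\<And>a. a \<in> insert p T \<Longrightarrow> r < a" and sel: "sel (insert p T) = p"
  shows "v @ r # v' \<in> andre_words sel (insert r (insert p T)) \<longleftrightarrow>
    set v \<subseteq> T \<and> v \<in> andre_words sel (set v) \<and> v' \<in> andre_words sel (insert p (T - set v))"
proof (cases "distinct v \<and> distinct v' \<and> set v \<subseteq> insert p T \<and> set v' = insert p T - set v")
  case True
  have "r \<notin> insert p T" using less by blast
  then have word: "set (v @ r # v') = insert r (insert p T)" "distinct (v @ r # v')"
    and rest: "set (v @ v') = insert p T"
    using True by auto
  moreover have "v @ v' \<noteq> []" using rest by auto
  ultimately have "andre_by sel (v @ r # v') \<longleftrightarrow> andre_by sel v \<and> andre_by sel v' \<and> p \<in> set v'"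
    using less sel by (subst andre_by_append_Cons_iff) auto
  moreover have "p \<in> set v' \<longleftrightarrow> set v \<subseteq> T" using True assms(1) by auto
  moreover have "set v' = insert p (T - set v)" if "set v \<subseteq> T" using that True assms(1) by auto
  ultimately show ?thesis using True word by (auto simp: andre_words_def)
next
  case False
  have "set v \<subseteq> insert p T \<and> set v' = insert p T - set v"
    if "set (v @ r # v') = insert r (insert p T)" "distinct (v @ r # v')"
  proof -
    have "r \<notin> insert p T" "r \<notin> set v \<union> set v'" using less that(2) by auto
    then have "set v \<union> set v' = insert p T" using that(1) by (simp add: insert_ident)
    then show ?thesis using that(2) by auto
  qed
  then show ?thesis using False assms(1) by (auto simp: andre_words_def)
qed

lemma andre_count_split:
  assumes "finite T" "p \<notin> T" and less: "\<And>a. a \<in> insert p T \<Longrightarrow> r < a"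
    and sel: "sel (insert p T) = p"
    and split: "\<And>v v'. set v \<subseteq> T \<Longrightarrow> set v' = insert p (T - set v) \<Longrightarrow>
                  P (v @ r # v') \<longleftrightarrow> Q v \<and> Q' v'"
  shows "andre_count sel P (insert r (insert p T)) =
    (andre_count sel Q \<star> \<partial> p (andre_count sel Q')) T"
proof -
  let ?left = "\<lambda>A. {v \<in> andre_words sel A. Q v}"
  let ?right = "\<lambda>A. {v' \<in> andre_words sel (insert p (T - A)). Q' v'}"
  define pairs where "pairs = (\<Union>A\<in>Pow T. ?left A \<times> ?right A)"
  define words where "words = {w \<in> andre_words sel (insert r (insert p T)). P w}"
  have r: "r \<notin> insert p T" using less by blast
  have pairs_iff: "(v, v') \<in> pairs \<longleftrightarrow> set v \<subseteq> T \<and> v \<in> ?left (set v) \<and> v' \<in> ?right (set v)"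
    for v v'
    by (auto simp: pairs_def andre_words_def)
  have join: "v @ r # v' \<in> words \<longleftrightarrow> (v, v') \<in> pairs" for v v'
  proof -
    have "v @ r # v' \<in> andre_words sel (insert r (insert p T)) \<longleftrightarrow>
        set v \<subseteq> T \<and> v \<in> andre_words sel (set v) \<and> v' \<in> andre_words sel (insert p (T - set v))"
      using assms(2) less sel by (rule append_Cons_in_andre_words_iff)
    moreover have "set v' = B" if "v' \<in> andre_words sel B" for B
      using that by (simp add: andre_words_def)
    ultimately show ?thesis
      unfolding pairs_iff words_def mem_Collect_eq using split[of v v'] by metis
  qed
  have "bij_betw (\<lambda>(v, v'). v @ r # v') pairs words"
  proof (rule bij_betw_imageI)
    have "r \<notin> set v" "r \<notin> set v'" if "(v, v') \<in> pairs" for v v'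
      using that r by (auto simp: pairs_iff andre_words_def)
    then show "inj_on (\<lambda>(v, v'). v @ r # v') pairs"
      by (auto simp: inj_on_def append_Cons_eq_iff)
    show "(\<lambda>(v, v'). v @ r # v') ` pairs = words"
    proof (intro equalityI subsetI)
      fix w assume w: "w \<in> words"
      then have "r \<in> set w" by (auto simp: words_def andre_words_def)
      then obtain v v' where "w = v @ r # v'" by (meson split_list)
      then show "w \<in> (\<lambda>(v, v'). v @ r # v') ` pairs"
        using w join by (intro image_eqI[of _ _ "(v, v')"]) simp_all
    qed (use join in auto)
  qed
  then have "andre_count sel P (insert r (insert p T)) = card pairs"
    by (simp add: andre_count_def words_def bij_betw_same_card)
  also have "\<dots> = (\<Sum>A\<in>Pow T. card (?left A \<times> ?right A))"
    unfolding pairs_def using assms(1)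
    by (intro card_UN_disjoint) (simp_all, auto simp: andre_words_def)
  finally show ?thesis
    by (simp add: set_conv_def set_deriv_def andre_count_def card_cartesian_product)
qed

text \<open>In an Andre II word the least letter of the rest lies to the right of the least letter, while
  the greatest letter \<open>N\<close> may lie on either side.\<close>

lemma andre_count_Min_split:
  assumes "r < q" "q < N" "S \<subseteq> {q<..<N}"
    and split: "\<And>v v'. set v \<union> set v' = insert q (insert N S) \<Longrightarrow> q \<in> set v' \<Longrightarrow> P (v @ r # v') \<longleftrightarrow>
                  (if N \<in> set v then Q v \<and> Q' v' else P' v \<and> P'' v')"
  shows "andre_count Min P (insert r (insert q (insert N S))) =
    (\<partial> N (andre_count Min Q) \<star> \<partial> q (andre_count Min Q')) S +
    (andre_count Min P' \<star> \<partial> N (\<partial> q (andre_count Min P''))) S"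
proof -
  let ?left = "\<lambda>v. if N \<in> set v then Q v else P' v"
  let ?right = "\<lambda>v'. if N \<in> set v' then P'' v' else Q' v'"
  have S: "finite S" "N \<notin> S" "q \<notin> S" using assms(3) finite_subset by auto
  have Min: "Min (insert q (insert N S)) = q"
    using assms(2,3) S by (intro Min_eqI) (auto intro: less_imp_le)
  have "andre_count Min P (insert r (insert q (insert N S))) =
      (andre_count Min ?left \<star> \<partial> q (andre_count Min ?right)) (insert N S)"
  proof (rule andre_count_split)
    fix v v' assume v: "set v \<subseteq> insert N S" "set v' = insert q (insert N S - set v)"
    then have "N \<in> set v' \<longleftrightarrow> N \<notin> set v" "set v \<union> set v' = insert q (insert N S)" "q \<in> set v'"
      using assms(2) by auto
    then show "P (v @ r # v') \<longleftrightarrow> ?left v \<and> ?right v'" using split by simp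
  qed (use assms S Min in auto)
  also have "\<dots> = (\<partial> N (andre_count Min ?left) \<star> \<partial> q (andre_count Min ?right)) S +
      (andre_count Min ?left \<star> \<partial> N (\<partial> q (andre_count Min ?right))) S"
    using S by (intro set_conv_insert)
  also have "(\<partial> N (andre_count Min ?left) \<star> \<partial> q (andre_count Min ?right)) S =
      (\<partial> N (andre_count Min Q) \<star> \<partial> q (andre_count Min Q')) S"
    using S assms(2) by (intro set_conv_cong) (auto simp: set_deriv_def intro!: andre_count_cong)
  also have "(andre_count Min ?left \<star> \<partial> N (\<partial> q (andre_count Min ?right))) S =
      (andre_count Min P' \<star> \<partial> N (\<partial> q (andre_count Min P''))) S"
    using S by (intro set_conv_cong)
      (auto simp: set_deriv_def intro!: andre_count_cong)
  finally show ?thesis .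
qed

subsection \<open>The greater neighbour of the greatest letter\<close>

text \<open>In the increasing binary tree of a word the greater neighbour of the greatest letter is its
  parent. The letter \<open>s\<close> on both sides of the word stands for the parent of the whole tree.\<close>

definition bordered_grn :: "nat \<Rightarrow> nat list \<Rightarrow> nat" where
  "bordered_grn s w =
     max (last (s # takeWhile (\<lambda>x. x \<noteq> Max (set w)) w))
         (hd (tl (dropWhile (\<lambda>x. x \<noteq> Max (set w)) w) @ [s]))"

lemma bordered_grn_at_Max:
  assumes "Max (set (p @ N # q)) = N" "N \<notin> set p"
  shows "bordered_grn s (p @ N # q) = max (last (s # p)) (hd (q @ [s]))"
proof -
  have "takeWhile (\<lambda>x. x \<noteq> N) (p @ N # q) = p" "dropWhile (\<lambda>x. x \<noteq> N) (p @ N # q) = N # q"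
    using assms(2) by (subst takeWhile_append2 dropWhile_append2; auto)+
  then show ?thesis unfolding bordered_grn_def assms(1) by simp
qed

lemma bordered_grn_singleton [simp]: "bordered_grn s [x] = s"
  by (simp add: bordered_grn_def)

lemma split_list_at_Max:
  fixes w :: "'a::linorder list"
  assumes "w \<noteq> []"
  obtains p q where "w = p @ Max (set w) # q" "Max (set w) \<notin> set p"
  using assms by (metis List.finite_set Max_in set_empty split_list_first)

lemma bordered_grn_append_Cons:
  assumes "N \<in> set v \<union> set v'" "set v \<union> set v' \<subseteq> {r<..N}" "s \<le> r"
  shows "bordered_grn s (v @ r # v') = bordered_grn r (if N \<in> set v then v else v')"
proof -
  define u where "u = (if N \<in> set v then v else v')"
  have "N \<in> set u" using assms(1) by (auto simp: u_def)
  then obtain p q where u: "u = p @ N # q" "N \<notin> set p" by (meson split_list_first)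
  define p' where "p' = (if N \<in> set v then p else v @ r # p)"
  define q' where "q' = (if N \<in> set v then q @ r # v' else q)"
  have bounds: "r < a" "a \<le> N" if "a \<in> set v \<union> set v'" for a
    using that assms(2) by (meson greaterThanAtMost_iff subsetD)+
  have whole: "v @ r # v' = p' @ N # q'" "N \<notin> set p'"
    using u bounds(1)[OF assms(1)] by (auto simp: u_def p'_def q'_def split: if_splits)
  have bounds_u: "r < a" "a \<le> N" if "a \<in> set u" for a
    using that bounds by (auto simp: u_def split: if_splits)
  then have "p \<noteq> [] \<Longrightarrow> r < last p" "q \<noteq> [] \<Longrightarrow> r < hd q" unfolding u(1) by simp_all
  then have "max (last (s # p')) (hd (q' @ [s])) = max (last (r # p)) (hd (q @ [r]))"
    using \<open>s \<le> r\<close> by (cases q) (auto simp: max_def p'_def q'_def)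
  moreover have "Max (set (v @ r # v')) = N" "Max (set u) = N"
    using assms(1) \<open>N \<in> set u\<close> bounds bounds_u(2) by (auto intro!: Max_eqI intro: less_imp_le)
  ultimately have "bordered_grn s (v @ r # v') = bordered_grn r u"
    using whole u bordered_grn_at_Max by metis
  then show ?thesis by (simp add: u_def)
qed

lemma bordered_grn_mem:
  assumes "distinct w" "w \<noteq> []"
  shows "bordered_grn s w \<in> insert s (set w - {Max (set w)})"
proof -
  obtain p q where w: "w = p @ Max (set w) # q" "Max (set w) \<notin> set p"
    using split_list_at_Max[OF assms(2)] .
  moreover have "Max (set w) \<notin> set q"
    using assms(1) w(1) by (metis distinct.simps(2) distinct_append)
  moreover have "last (s # p) \<in> insert s (set p)" by auto
  moreover have "hd (q @ [s]) \<in> insert s (set q)" by (cases q) auto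
  moreover have "bordered_grn s w = max (last (s # p)) (hd (q @ [s]))"
    using bordered_grn_at_Max[of p "Max (set w)" q] w by metis
  moreover have "set p \<union> set q \<subseteq> set w"
    by (subst w(1)) auto
  ultimately show ?thesis by (auto simp: max_def)
qed

lemma bordered_grn_snoc_Max:
  assumes "\<And>a. a \<in> set u \<Longrightarrow> s \<le> a \<and> a < N"
  shows "bordered_grn s (u @ [N]) = last (s # u)"
proof -
  have "Max (set (u @ N # [])) = N" using assms by (intro Max_eqI) (auto intro: less_imp_le)
  moreover have "N \<notin> set u" using assms by blast
  moreover have "s \<le> last (s # u)" using assms last_in_set[of u] by auto
  ultimately show ?thesis
    using bordered_grn_at_Max[of u N "[]" s] by (simp add: max_absorb1 del: last.simps)
qed

subsection \<open>Counting by end letter and greater neighbour of the greatest letter\<close>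

definition grn_count :: "(nat set \<Rightarrow> nat) \<Rightarrow> nat \<Rightarrow> nat set \<Rightarrow> nat set \<Rightarrow> nat" where
  "grn_count sel s K = andre_count sel (\<lambda>w. bordered_grn s w \<in> K)"

definition end_count ::
    "(nat set \<Rightarrow> nat) \<Rightarrow> (nat list \<Rightarrow> nat) \<Rightarrow> nat \<Rightarrow> nat set \<Rightarrow> nat \<Rightarrow> nat set \<Rightarrow> nat" where
  "end_count sel pick s K m = andre_count sel (\<lambda>w. w \<noteq> [] \<and> pick w = m \<and> bordered_grn s w \<in> K)"

abbreviation "first_count \<equiv> end_count Max hd"
abbreviation "last_count \<equiv> end_count Min last"

text \<open>For \<open>K = UNIV\<close> the border \<open>s\<close> is immaterial.\<close>

abbreviation "num_words sel \<equiv> grn_count sel 0 UNIV"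
abbreviation "num_first \<equiv> first_count 0 UNIV"
abbreviation "num_last \<equiv> last_count 0 UNIV"

lemma grn_count_UNIV: "grn_count sel s UNIV = num_words sel"
  by (simp add: grn_count_def)

lemma num_words_empty [simp]: "num_words sel {} = 1"
  by (simp add: grn_count_def)

lemma grn_count_singleton [simp]: "grn_count sel s K {x} = (if s \<in> K then 1 else 0)"
  by (simp add: grn_count_def)

lemma end_count_empty [simp]: "end_count sel pick s K m {} = 0"
  by (simp add: end_count_def)

lemma end_count_singleton:
  assumes "pick \<in> {hd, last}"
  shows "end_count sel pick s K m {x} = (if m = x \<and> s \<in> K then 1 else 0)"
  using assms by (auto simp: end_count_def)

lemma hd_last_in_set: "pick \<in> {hd, last} \<Longrightarrow> w \<noteq> [] \<Longrightarrow> pick w \<in> set w"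
  by auto

lemma end_count_notin:
  assumes "pick \<in> {hd, last}" "m \<notin> Y"
  shows "end_count sel pick s K m Y = 0"
  unfolding end_count_def using assms hd_last_in_set[OF assms(1)] by (intro andre_count_eq_0) auto

lemma grn_count_eq_0:
  assumes "Y \<noteq> {}" "K \<inter> insert s (Y - {Max Y}) = {}"
  shows "grn_count sel s K Y = 0"
  unfolding grn_count_def
proof (rule andre_count_eq_0)
  fix w :: "nat list" assume "set w = Y" "distinct w"
  then show "bordered_grn s w \<notin> K" using bordered_grn_mem[of w s] assms by auto
qed

lemma end_count_eq_0:
  assumes "K \<inter> insert s (Y - {Max Y}) = {}"
  shows "end_count sel pick s K m Y = 0"
  unfolding end_count_def
proof (rule andre_count_eq_0)
  fix w :: "nat list" assume "set w = Y" "distinct w"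
  then show "\<not> (w \<noteq> [] \<and> pick w = m \<and> bordered_grn s w \<in> K)"
    using bordered_grn_mem[of w s] assms by auto
qed

lemma sum_end_count:
  assumes "finite Y" "Y \<noteq> {}" "pick \<in> {hd, last}"
  shows "(\<Sum>m\<in>Y. end_count sel pick s K m Y) = grn_count sel s K Y"
proof -
  define words where "words = {w \<in> andre_words sel Y. bordered_grn s w \<in> K}"
  have words: "w \<noteq> []" "pick w \<in> Y" if "w \<in> words" for w
    using that assms(2) hd_last_in_set[OF assms(3), of w] by (auto simp: words_def andre_words_def)
  have "finite words" by (simp add: words_def)
  have "(\<Sum>m\<in>Y. end_count sel pick s K m Y) = (\<Sum>m\<in>Y. card {w \<in> words. pick w = m})"
    unfolding end_count_def andre_count_def using words(1)
    by (intro sum.cong refl arg_cong[of _ _ card]) (auto simp: words_def)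
  also have "\<dots> = card (\<Union>m\<in>Y. {w \<in> words. pick w = m})"
    using assms(1) \<open>finite words\<close> by (intro card_UN_disjoint[symmetric]) auto
  also have "(\<Union>m\<in>Y. {w \<in> words. pick w = m}) = words"
    using words(2) by auto
  finally show ?thesis by (simp add: words_def grn_count_def andre_count_def)
qed

subsection \<open>Order isomorphisms\<close>

lemma strict_mono_on_Max:
  fixes f :: "nat \<Rightarrow> nat"
  assumes "strict_mono_on S f" "finite S" "S \<noteq> {}"
  shows "Max (f ` S) = f (Max S)"
  using assms(2) Max_in[OF assms(2,3)]
  by (intro Max_eqI) (auto intro!: strict_mono_on_leD[OF assms(1)])

lemma strict_mono_on_Min:
  fixes f :: "nat \<Rightarrow> nat"
  assumes "strict_mono_on S f" "finite S" "S \<noteq> {}"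
  shows "Min (f ` S) = f (Min S)"
  using assms(2) Min_in[OF assms(2,3)]
  by (intro Min_eqI) (auto intro!: strict_mono_on_leD[OF assms(1)])

lemma andre_by_map:
  assumes "andre_by sel w" "strict_mono_on (set w) f" "sel \<in> {Max, Min}"
  shows "andre_by sel (map f w)"
  using assms
proof (induction rule: andre_by.induct)
  case (split v x v')
  have mono: "strict_mono_on (set v) f" "strict_mono_on (set v') f"
    "strict_mono_on (set (v @ v')) f"
    using split.prems(1) by (auto intro: monotone_on_subset)
  have nonempty: "set (v @ v') \<noteq> {}" using split.hyps(2) by simp
  have "andre_by sel (map f v @ f x # map f v')"
  proof (rule andre_by.split)
    show "distinct (map f v @ f x # map f v')"
      using split.hyps(1) strict_mono_on_imp_inj_on[OF split.prems(1)]
      by (metis distinct_map list.map(2) map_append)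
    show "map f v @ map f v' \<noteq> []" using split.hyps(2) by simp
    have "Min (f ` set (v @ x # v')) = f (Min (set (v @ x # v')))"
      using split.prems(1) by (rule strict_mono_on_Min) auto
    then show "f x = Min (set (map f v @ f x # map f v'))"
      using split.hyps(3) by (simp add: image_Un)
    have "sel (f ` set (v @ v')) = f (sel (set (v @ v')))"
      using strict_mono_on_Max[OF mono(3) _ nonempty] strict_mono_on_Min[OF mono(3) _ nonempty]
        split.prems(2) by auto
    then show "sel (set (map f v @ map f v')) \<in> set (map f v')"
      using split.hyps(6) by (simp add: image_Un)
  qed (use split.IH mono split.prems(2) in auto)
  then show ?case by simp
qed (auto intro: andre_by.intros)

lemma map_in_andre_words:
  assumes "w \<in> andre_words sel Y" "strict_mono_on Y f" "sel \<in> {Max, Min}"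
  shows "map f w \<in> andre_words sel (f ` Y)"
  using assms andre_by_map[of sel w f] strict_mono_on_imp_inj_on[OF assms(2)]
  by (simp add: andre_words_def distinct_map)

lemma andre_words_image:
  assumes mono: "strict_mono_on Y f" and sel: "sel \<in> {Max, Min}"
  shows "andre_words sel (f ` Y) = map f ` andre_words sel Y"
proof (intro equalityI subsetI)
  fix w assume "w \<in> map f ` andre_words sel Y"
  then show "w \<in> andre_words sel (f ` Y)" using map_in_andre_words[OF _ mono sel] by auto
next
  fix w assume w: "w \<in> andre_words sel (f ` Y)"
  define g where "g = the_inv_into Y f"
  have inverse: "g (f y) = y" if "y \<in> Y" for y
    using that strict_mono_on_imp_inj_on[OF mono] by (simp add: g_def the_inv_into_f_f)
  have "strict_mono_on (f ` Y) g"
    using strict_mono_on_less[OF mono] inverse by (auto intro!: strict_mono_onI)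
  then have "map g w \<in> andre_words sel (g ` f ` Y)" using w sel by (intro map_in_andre_words)
  moreover have "g ` f ` Y = Y" using inverse by force
  moreover have "map f (map g w) = w"
    unfolding map_map using w inverse by (intro map_idI) (auto simp: andre_words_def)
  ultimately show "w \<in> map f ` andre_words sel Y" by (metis imageI)
qed

lemma andre_count_image:
  assumes mono: "strict_mono_on Y f" and sel: "sel \<in> {Max, Min}"
    and map: "\<And>w. set w = Y \<Longrightarrow> distinct w \<Longrightarrow> Q (map f w) \<longleftrightarrow> P w"
  shows "andre_count sel Q (f ` Y) = andre_count sel P Y"
proof -
  have "{w \<in> andre_words sel (f ` Y). Q w} = map f ` {w \<in> andre_words sel Y. P w}"
    unfolding andre_words_image[OF mono sel] using map by (auto simp: andre_words_def)
  moreover have "inj_on (map f) {w \<in> andre_words sel Y. P w}"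
    by (rule inj_on_mapI, rule inj_on_subset[OF strict_mono_on_imp_inj_on[OF mono]])
      (auto simp: andre_words_def)
  ultimately show ?thesis by (simp add: andre_count_def card_image)
qed

lemma bordered_grn_map:
  assumes mono: "strict_mono_on (insert s (set w)) f" and "w \<noteq> []"
  shows "bordered_grn (f s) (map f w) = f (bordered_grn s w)"
proof -
  define N where "N = Max (set w)"
  obtain p q where w: "w = p @ N # q" "N \<notin> set p"
    unfolding N_def using split_list_at_Max[OF assms(2)] .
  have "strict_mono_on (set w) f" using mono by (rule monotone_on_subset) auto
  then have Max: "Max (set (map f w)) = f N" using assms(2) by (simp add: N_def strict_mono_on_Max)
  have "inj_on f (set w)" using mono strict_mono_on_imp_inj_on inj_on_subset by blast
  then have "f N \<notin> set (map f p)" using w by (auto simp: inj_on_def)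
  then have "bordered_grn (f s) (map f w) = max (last (f s # map f p)) (hd (map f q @ [f s]))"
    using bordered_grn_at_Max[of "map f p" "f N" "map f q" "f s"] Max unfolding w(1) by simp
  also have "last (f s # map f p) = f (last (s # p))" by (cases p) (auto simp: last_map)
  also have "hd (map f q @ [f s]) = f (hd (q @ [s]))" by (cases q) auto
  also have "max (f (last (s # p))) (f (hd (q @ [s]))) = f (max (last (s # p)) (hd (q @ [s])))"
  proof -
    have "last (s # p) \<in> insert s (set w)" "hd (q @ [s]) \<in> insert s (set w)"
      using w by (auto simp: hd_append)
    then show ?thesis
      using strict_mono_on_less_eq[OF mono] by (auto simp: max_def simp del: last.simps)
  qed
  also have "max (last (s # p)) (hd (q @ [s])) = bordered_grn s w"
    using bordered_grn_at_Max[of p N q s] w unfolding N_def by simp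
  finally show ?thesis .
qed

context
  fixes f :: "nat \<Rightarrow> nat" and sel :: "nat set \<Rightarrow> nat" and s :: nat and Y K K' :: "nat set"
  assumes Y: "Y \<noteq> {}" and mono: "strict_mono_on (insert s Y) f" and sel: "sel \<in> {Max, Min}"
    and K: "\<And>k. k \<in> insert s Y \<Longrightarrow> f k \<in> K' \<longleftrightarrow> k \<in> K"
begin

lemma strict_mono_on_letters: "strict_mono_on Y f"
  using mono by (rule monotone_on_subset) auto

lemma bordered_grn_map_mem_iff:
  assumes "set w = Y" "distinct w"
  shows "bordered_grn (f s) (map f w) \<in> K' \<longleftrightarrow> bordered_grn s w \<in> K"
proof -
  have "w \<noteq> []" using assms(1) Y by auto
  then show ?thesis
    using bordered_grn_map[of s w f] bordered_grn_mem[of w s] assms mono K by auto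
qed

lemma grn_count_image: "grn_count sel (f s) K' (f ` Y) = grn_count sel s K Y"
  unfolding grn_count_def
  using strict_mono_on_letters sel bordered_grn_map_mem_iff by (rule andre_count_image)

lemma end_count_image:
  assumes "pick \<in> {hd, last}" "m \<in> Y"
  shows "end_count sel pick (f s) K' (f m) (f ` Y) = end_count sel pick s K m Y"
  unfolding end_count_def
proof (rule andre_count_image[OF strict_mono_on_letters sel])
  fix w assume w: "set w = Y" "distinct w"
  then have "w \<noteq> []" using Y by auto
  then have "pick (map f w) = f (pick w)" "pick w \<in> Y"
    using assms(1) hd_last_in_set[of pick w] w(1) by (auto simp: hd_map last_map)
  then show "(map f w \<noteq> [] \<and> pick (map f w) = f m \<and> bordered_grn (f s) (map f w) \<in> K') \<longleftrightarrow>
      (w \<noteq> [] \<and> pick w = m \<and> bordered_grn s w \<in> K)"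
    using bordered_grn_map_mem_iff[OF w] \<open>w \<noteq> []\<close> assms(2)
      inj_on_eq_iff[OF strict_mono_on_imp_inj_on[OF strict_mono_on_letters]] by simp
qed

end

lemma strict_mono_on_replace:
  fixes x y :: "'a::linorder"
  assumes "x < y" "A \<inter> {x..y} = {}"
  shows "strict_mono_on (insert x A) (id(x := y))"
proof (rule strict_mono_onI)
  have outside: "a < x \<or> y < a" if "a \<in> A" for a using that assms(2) by force
  fix a b assume "a \<in> insert x A" "b \<in> insert x A" "a < b"
  then show "(id(x := y)) a < (id(x := y)) b"
    using outside[of a] outside[of b] assms(1) by auto
qed

context
  fixes x y s :: nat and A K :: "nat set"
  assumes xy: "x < y" "A \<inter> {x..y} = {}" "s < x" and K: "x \<in> K \<longleftrightarrow> y \<in> K"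
begin

lemma replace_mono: "strict_mono_on (insert s (insert x A)) (id(x := y))"
  using strict_mono_on_replace[of x y "insert s A"] xy by (simp add: insert_commute)

lemma replace_image: "(id(x := y)) ` insert x A = insert y A"
  using xy by force

lemma grn_count_replace:
  assumes "sel \<in> {Max, Min}"
  shows "grn_count sel s K (insert x A) = grn_count sel s K (insert y A)"
  using grn_count_image[OF _ replace_mono assms, of K K] K xy(3)
  unfolding replace_image by simp

lemma end_count_replace:
  assumes "sel \<in> {Max, Min}" "pick \<in> {hd, last}"
  shows "end_count sel pick s K x (insert x A) = end_count sel pick s K y (insert y A)"
  using end_count_image[OF _ replace_mono assms(1) _ assms(2), of K K x] K xy(3)
  unfolding replace_image by simp

end

lemma grn_count_replace_border:
  assumes "s < t" "Y \<subseteq> {t<..}" "Y \<noteq> {}" "s \<in> K \<longleftrightarrow> t \<in> K" "sel \<in> {Max, Min}"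
  shows "grn_count sel s K Y = grn_count sel t K Y"
proof -
  have "strict_mono_on (insert s Y) (id(s := t))"
    using assms(1,2) by (intro strict_mono_on_replace) auto
  then have "grn_count sel ((id(s := t)) s) K ((id(s := t)) ` Y) = grn_count sel s K Y"
    using assms by (intro grn_count_image[where f = "id(s := t)"]) auto
  moreover have "(id(s := t)) ` Y = Y" using assms(1,2) by force
  ultimately show ?thesis by simp
qed

lemma num_words_eq_if_card_eq:
  assumes "finite Y" "finite Z" "card Y = card Z" "sel \<in> {Max, Min}"
  shows "num_words sel Y = num_words sel Z"
proof -
  have "num_words sel X = num_words sel {..<card X}" if "finite X" for X :: "nat set"
  proof -
    obtain h where "bij_betw h {..<card X} X" "strict_mono_on {..<card X} h"
      using \<open>finite X\<close> by (rule ex_bij_betw_strict_mono_card)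
    then show ?thesis
      unfolding grn_count_def
      using andre_count_image[of "{..<card X}" h sel "\<lambda>w. True" "\<lambda>w. True"] assms(4)
      by (simp add: bij_betw_def)
  qed
  then show ?thesis using assms by metis
qed

subsection \<open>Recurrences\<close>

lemma finite_Min_Max_cases [consumes 1, case_names empty singleton insert]:
  fixes Y :: "nat set"
  assumes "finite Y"
  obtains "Y = {}" | x where "Y = {x}"
  | r N S where "r < N" "S \<subseteq> {r<..<N}" "Y = insert r (insert N S)"
proof (cases "Y = {}")
  case False
  have bounds: "Min Y \<le> a" "a \<le> Max Y" if "a \<in> Y" for a using assms that by auto
  have mem: "Min Y \<in> Y" "Max Y \<in> Y" using False assms by simp_all
  show ?thesis
  proof (cases "Min Y = Max Y")
    case True
    then have "Y = {Min Y}" using bounds mem by (auto intro: antisym)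
    then show ?thesis by (rule that(2))
  next
    case False
    show ?thesis
    proof (rule that(3))
      show "Min Y < Max Y" using False bounds(2)[OF mem(1)] by simp
      show "Y - {Min Y, Max Y} \<subseteq> {Min Y<..<Max Y}"
        using bounds by (auto simp: order.strict_iff_order)
      show "Y = insert (Min Y) (insert (Max Y) (Y - {Min Y, Max Y}))" using mem by auto
    qed
  qed
qed (use that in blast)

lemma finite_Min_subset_induct [consumes 1, case_names empty insert]:
  fixes Y :: "'a::linorder set"
  assumes "finite Y" and "P {}"
    and step: "\<And>q Q. finite Q \<Longrightarrow> (\<And>a. a \<in> Q \<Longrightarrow> q < a) \<Longrightarrow> (\<And>A. A \<subseteq> Q \<Longrightarrow> P A) \<Longrightarrow>
                 P (insert q Q)"
  shows "P Y"
proof -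
  have "\<forall>A\<subseteq>Y. P A"
    using \<open>finite Y\<close>
  proof (induction rule: finite_linorder_min_induct)
    case (insert q Q)
    have "P A" if "A \<subseteq> insert q Q" for A
    proof (cases "q \<in> A")
      case True
      have "finite (A - {q})" "A - {q} \<subseteq> Q" using that insert.hyps(1) finite_subset by auto
      then have "P (insert q (A - {q}))"
        using insert.hyps(2) insert.IH by (intro step) auto
      then show ?thesis using True by (simp add: insert_absorb)
    qed (use that insert.IH in auto)
    then show ?case by blast
  qed (use \<open>P {}\<close> in simp)
  then show ?thesis by blast
qed

lemma Max_insert_above: "S \<subseteq> {r<..<N} \<Longrightarrow> Max (insert N S) = (N :: nat)"
  using finite_subset[of S "{r<..<N}"] by (intro Max_eqI) auto

lemma grn_count_split:
  assumes "s \<le> r" "r < N" "S \<subseteq> {r<..<N}" "sel (insert N S) = N"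
  shows "grn_count sel s K (insert r (insert N S)) = (num_words sel \<star> \<partial> N (grn_count sel r K)) S"
  unfolding grn_count_def
proof (rule andre_count_split)
  fix v v' assume v: "set v \<subseteq> S" "set v' = insert N (S - set v)"
  then have "bordered_grn s (v @ r # v') = bordered_grn r (if N \<in> set v then v else v')"
    using assms by (intro bordered_grn_append_Cons) auto
  moreover have "N \<notin> set v" using v(1) assms(3) by auto
  ultimately show "bordered_grn s (v @ r # v') \<in> K \<longleftrightarrow>
      bordered_grn 0 v \<in> UNIV \<and> bordered_grn r v' \<in> K" by simp
qed (use assms finite_subset[OF assms(3)] in auto)

lemma grn_count_rec:
  assumes "s \<le> r" "r < N" "S \<subseteq> {r<..<N}" "sel \<in> {Max, Min}"
  shows "grn_count sel s K (insert r (insert N S)) = (num_words sel \<star> \<partial> N (grn_count sel r K)) S"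
proof (cases "sel (insert N S) = N")
  case True
  then show ?thesis using assms by (intro grn_count_split) auto
next
  case False
  define q where "q = Min S"
  define Q where "Q = S - {q}"
  have S: "finite S" "S \<noteq> {}" and sel: "sel = Min"
    using False assms(3,4) Max_insert_above[OF assms(3)] finite_subset[OF assms(3)] by auto
  then have q: "q \<in> S" "\<And>a. a \<in> S \<Longrightarrow> q \<le> a" by (auto simp: q_def)
  then have Q: "S = insert q Q" "q \<notin> Q" "finite Q" "r < q" "q < N" "Q \<subseteq> {q<..<N}"
    using S(1) assms(3) by (auto simp: Q_def order.strict_iff_order)
  have "grn_count Min s K (insert r (insert q (insert N Q))) =
     (\<partial> N (grn_count Min r K) \<star> \<partial> q (num_words Min)) Q +
     (num_words Min \<star> \<partial> N (\<partial> q (grn_count Min r K))) Q"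
    unfolding grn_count_def
  proof (rule andre_count_Min_split[OF Q(4-6)])
    fix v v' :: "nat list" assume "set v \<union> set v' = insert q (insert N Q)"
    then have "bordered_grn s (v @ r # v') = bordered_grn r (if N \<in> set v then v else v')"
      using assms(1) Q by (intro bordered_grn_append_Cons) auto
    then show "bordered_grn s (v @ r # v') \<in> K \<longleftrightarrow>
        (if N \<in> set v then bordered_grn r v \<in> K \<and> bordered_grn 0 v' \<in> UNIV
         else bordered_grn 0 v \<in> UNIV \<and> bordered_grn r v' \<in> K)" by simp
  qed
  also have "\<dots> = (num_words Min \<star> \<partial> N (grn_count Min r K)) (insert q Q)"
    using Q(2,3)
    by (simp add: set_conv_insert set_conv_commute[of "\<partial> N _"] set_deriv_commute[of q N])
  finally show ?thesis unfolding sel Q(1) by (simp add: insert_commute)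
qed

lemma grn_count_Min_eq_Max:
  assumes "finite Y" "\<And>a. a \<in> Y \<Longrightarrow> s \<le> a"
  shows "grn_count Min s K Y = grn_count Max s K Y"
  using assms
proof (induction arbitrary: s K rule: finite_psubset_induct)
  case (psubset Y)
  show ?case using psubset.hyps
  proof (cases rule: finite_Min_Max_cases)
    case (insert r N S)
    have "s \<le> r" using psubset.prems insert(3) by simp
    have "r \<notin> S" "r \<noteq> N" using insert(1,2) by auto
    have "(num_words Min \<star> \<partial> N (grn_count Min r K)) S =
        (num_words Max \<star> \<partial> N (grn_count Max r K)) S"
    proof (rule set_conv_cong)
      fix A assume A: "A \<subseteq> S"
      have "A \<subseteq> Y" "insert N A \<subseteq> Y" "r \<in> Y" "r \<notin> insert N A"
        using A insert \<open>r \<notin> S\<close> \<open>r \<noteq> N\<close> by auto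
      then have "A \<subset> Y" "insert N A \<subset> Y" by auto
      moreover have "r \<le> a" if "a \<in> insert N A" for a using that A insert(1,2) by auto
      ultimately show "num_words Min A = num_words Max A"
        "\<partial> N (grn_count Min r K) A = \<partial> N (grn_count Max r K) A"
        using psubset.IH[of A 0 UNIV] psubset.IH[of "insert N A" r K]
        by (auto simp: set_deriv_def)
    qed
    then show ?thesis
      unfolding insert(3) using grn_count_rec[OF \<open>s \<le> r\<close> insert(1,2)] by simp
  qed (simp_all add: grn_count_def)
qed

lemma first_count_split:
  assumes "s \<le> r" "r < N" "S \<subseteq> {r<..<N}"
    and Q: "\<And>v. set v \<subseteq> S \<Longrightarrow> Q v \<longleftrightarrow> hd (v @ [r]) = m"
  shows "first_count s K m (insert r (insert N S)) =
    (andre_count Max Q \<star> \<partial> N (grn_count Max r K)) S"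
  unfolding end_count_def grn_count_def
proof (rule andre_count_split)
  fix v v' assume v: "set v \<subseteq> S" "set v' = insert N (S - set v)"
  then have "bordered_grn s (v @ r # v') = bordered_grn r (if N \<in> set v then v else v')"
    using assms(1-3) by (intro bordered_grn_append_Cons) auto
  moreover have "N \<notin> set v" using v(1) assms(3) by auto
  ultimately show "(v @ r # v' \<noteq> [] \<and> hd (v @ r # v') = m \<and> bordered_grn s (v @ r # v') \<in> K) \<longleftrightarrow>
      Q v \<and> bordered_grn r v' \<in> K"
    using Q[OF v(1)] by (simp add: hd_append)
qed (use assms(1-3) Max_insert_above[OF assms(3)] finite_subset[OF assms(3)] in auto)

lemma first_count_rec:
  assumes "s \<le> r" "r < N" "S \<subseteq> {r<..<N}" "m \<noteq> r"
  shows "first_count s K m (insert r (insert N S)) = (num_first m \<star> \<partial> N (grn_count Max r K)) S"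
  unfolding end_count_def[of Max hd 0 UNIV m]
  using assms by (intro first_count_split) (auto simp: hd_append)

lemma insert_Max_cases [consumes 3, case_names insert]:
  fixes Y :: "nat set"
  assumes "finite Y" "Y \<noteq> {}" "Y \<subseteq> {r<..}"
  obtains N S where "r < N" "S \<subseteq> {r<..<N}" "Y = insert N S"
proof
  have "Max Y \<in> Y" using assms(1,2) by simp
  then show "r < Max Y" "Y = insert (Max Y) (Y - {Max Y})" using assms(3) by auto
  show "Y - {Max Y} \<subseteq> {r<..<Max Y}"
    using assms by (auto simp: order.strict_iff_order)
qed

lemma first_count_least:
  assumes "s \<le> r" "finite Y" "Y \<noteq> {}" "Y \<subseteq> {r<..}"
  shows "first_count s K r (insert r Y) = grn_count Max r K Y"
  using assms(2-4)
proof (cases rule: insert_Max_cases)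
  case (insert N S)
  have "r < hd v" if "set v \<subseteq> S" "v \<noteq> []" for v
    using that insert(2) hd_in_set[of v] by (meson greaterThanLessThan_iff subsetD)
  then have "v = [] \<longleftrightarrow> hd (v @ [r]) = r" if "set v \<subseteq> S" for v
    using that by (cases v) fastforce+
  then have "first_count s K r (insert r (insert N S)) =
      (andre_count Max (\<lambda>v. v = []) \<star> \<partial> N (grn_count Max r K)) S"
    using assms(1) insert(1,2) by (intro first_count_split)
  also have "\<dots> = grn_count Max r K (insert N S)"
  proof -
    have "andre_count Max (\<lambda>v. v = []) A = 0" if "A \<noteq> {}" for A
      using that by (intro andre_count_eq_0) auto
    then show ?thesis
      using finite_subset[OF insert(2)] by (simp add: set_conv_concentrated_left set_deriv_def)
  qed
  finally show ?thesis unfolding insert(3) .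
qed

lemma num_first_least:
  assumes "finite A" "A \<subseteq> {y<..}"
  shows "num_first y (insert y A) = num_words Max A"
proof (cases "A = {}")
  case False
  then show ?thesis
    using first_count_least[of 0 y A UNIV] assms by (simp add: grn_count_UNIV[of Max y])
qed (simp add: end_count_singleton)

lemma first_count_greatest:
  assumes "s \<le> r" "r < N" "S \<subseteq> {r<..<N}"
  shows "first_count s K N (insert r (insert N S)) = 0"
proof -
  have "(num_first N \<star> \<partial> N (grn_count Max r K)) S = 0"
    using assms(3) by (intro set_conv_eq_0) (auto intro!: end_count_notin)
  then show ?thesis using first_count_rec[OF assms] assms(2) by simp
qed

lemma num_first_greatest:
  assumes "A \<noteq> {}" "A \<subseteq> {..<N}"
  shows "num_first N (insert N A) = 0"
proof -
  have "finite A" using finite_subset[OF assms(2)] by simp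
  then have "Min A \<in> A" "\<And>a. a \<in> A \<Longrightarrow> Min A \<le> a" using assms(1) by simp_all
  then have "A = insert (Min A) (A - {Min A})" "Min A < N" "A - {Min A} \<subseteq> {Min A<..<N}"
    using assms(2) by (auto simp: order.strict_iff_order)
  then show ?thesis
    using first_count_greatest[of 0 "Min A" N "A - {Min A}" UNIV] by (metis insert_commute zero_le)
qed

lemma last_count_Min_split:
  assumes "s \<le> r" "r < q" "q < N" "S \<subseteq> {q<..<N}"
  shows "last_count s K m (insert r (insert q (insert N S))) =
    (\<partial> N (grn_count Max r K) \<star> \<partial> q (num_last m)) S +
    (num_words Max \<star> \<partial> N (\<partial> q (last_count r K m))) S"
proof -
  have S: "finite S" using assms(4) finite_subset[OF assms(4)] by simp
  have "last_count s K m (insert r (insert q (insert N S))) =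
      (\<partial> N (grn_count Min r K) \<star> \<partial> q (num_last m)) S +
      (num_words Min \<star> \<partial> N (\<partial> q (last_count r K m))) S"
    unfolding grn_count_def end_count_def
  proof (rule andre_count_Min_split[OF assms(2-4)])
    fix v v' :: "nat list" assume v: "set v \<union> set v' = insert q (insert N S)" "q \<in> set v'"
    then have "bordered_grn s (v @ r # v') = bordered_grn r (if N \<in> set v then v else v')"
      using assms by (intro bordered_grn_append_Cons) auto
    then show "(v @ r # v' \<noteq> [] \<and> last (v @ r # v') = m \<and> bordered_grn s (v @ r # v') \<in> K) \<longleftrightarrow>
        (if N \<in> set v
         then bordered_grn r v \<in> K \<and> v' \<noteq> [] \<and> last v' = m \<and> bordered_grn 0 v' \<in> UNIV
         else bordered_grn 0 v \<in> UNIV \<and> v' \<noteq> [] \<and> last v' = m \<and> bordered_grn r v' \<in> K)"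
      using v(2) by auto
  qed
  also have "(\<partial> N (grn_count Min r K) \<star> \<partial> q (num_last m)) S =
      (\<partial> N (grn_count Max r K) \<star> \<partial> q (num_last m)) S"
  proof (rule set_conv_cong)
    fix A assume "A \<subseteq> S"
    then show "\<partial> N (grn_count Min r K) A = \<partial> N (grn_count Max r K) A"
      unfolding set_deriv_def using assms S
      by (intro grn_count_Min_eq_Max) (auto intro: finite_subset)
  qed simp
  also have "(num_words Min \<star> \<partial> N (\<partial> q (last_count r K m))) S =
      (num_words Max \<star> \<partial> N (\<partial> q (last_count r K m))) S"
    using S by (intro set_conv_cong) (auto intro!: grn_count_Min_eq_Max intro: finite_subset)
  finally show ?thesis .
qed

lemma last_count_two_letters:
  assumes "s \<le> r" "r < N" "m \<noteq> N"
  shows "last_count s K m {r, N} = 0"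
proof -
  have "last_count s K m {r, N} = (num_words Min \<star> \<partial> N (last_count r K m)) {}"
    unfolding grn_count_def end_count_def
  proof (rule andre_count_split)
    fix v v' :: "nat list" assume "set v \<subseteq> {}" "set v' = insert N ({} - set v)"
    then have v: "v = []" "set v' = {N}" by auto
    then have "bordered_grn s (v @ r # v') = bordered_grn r v'"
      using assms bordered_grn_append_Cons[of N v v' r s] by simp
    moreover have "v' \<noteq> []" using v(2) by auto
    ultimately show "(v @ r # v' \<noteq> [] \<and> last (v @ r # v') = m \<and> bordered_grn s (v @ r # v') \<in> K) \<longleftrightarrow>
        bordered_grn 0 v \<in> UNIV \<and> v' \<noteq> [] \<and> last v' = m \<and> bordered_grn r v' \<in> K"
      by simp
  qed (use assms in auto)
  also have "\<dots> = 0" using assms(3) by (simp add: set_deriv_def end_count_singleton)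
  finally show ?thesis .
qed

text \<open>On trees: let \<open>r = p\<^sub>0 < p\<^sub>1 < \<dots>\<close> be the path of smallest children, which ends in \<open>m\<close>, let
  \<open>U\<^sub>j\<close> be the other subtree at \<open>p\<^sub>j\<close>, and let \<open>U\<^sub>i\<close> contain the greatest letter. Moving \<open>U\<^sub>j\<close> from
  \<open>p\<^sub>j\<close> to \<open>p\<^sub>j\<^sub>+\<^sub>1\<close> for \<open>j < i\<close> and cutting below \<open>p\<^sub>i\<close> leaves the subtree at \<open>p\<^sub>i\<^sub>+\<^sub>1\<close>, the
  first factor, and a tree on the remaining letters other than \<open>r\<close>.\<close>

lemma last_count_rec:
  assumes "s \<le> r" "r < N" "S \<subseteq> {r<..<N}" "m \<noteq> N"
  shows "last_count s K m (insert r (insert N S)) =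
    (num_last m \<star> \<partial> N (grn_count Max r K)) S"
proof -
  have "finite S" using finite_subset[OF assms(3)] by simp
  then show ?thesis
    using assms
  proof (induction arbitrary: r s rule: finite_Min_subset_induct)
    case empty
    then show ?case by (simp add: last_count_two_letters)
  next
    case (insert q Q)
    have q: "q \<notin> Q" "r < q" "q < N" and Q: "Q \<subseteq> {q<..<N}"
      using insert.hyps insert.prems by auto
    have "last_count r K m (insert q (insert N A)) = (num_last m \<star> \<partial> N (grn_count Max q K)) A"
      if "A \<subseteq> Q" for A
      using that q Q insert.prems(4) by (intro insert.IH) auto
    then have "(num_words Max \<star> \<partial> N (\<partial> q (last_count r K m))) Q =
        (num_words Max \<star> (num_last m \<star> \<partial> N (grn_count Max q K))) Q"
      by (intro set_conv_cong) (simp_all add: set_deriv_def)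
    also have "\<dots> = (num_last m \<star> (num_words Max \<star> \<partial> N (grn_count Max q K))) Q"
      using insert.hyps(1) by (rule set_conv_left_commute)
    also have "\<dots> = (num_last m \<star> \<partial> N (\<partial> q (grn_count Max r K))) Q"
    proof (rule set_conv_cong)
      fix A assume "A \<subseteq> Q"
      then show "(num_words Max \<star> \<partial> N (grn_count Max q K)) A = \<partial> N (\<partial> q (grn_count Max r K)) A"
        using grn_count_rec[of r q N A Max K] q Q by (auto simp: set_deriv_def)
    qed simp
    finally have "last_count s K m (insert r (insert q (insert N Q))) =
        (\<partial> N (grn_count Max r K) \<star> \<partial> q (num_last m)) Q +
        (num_last m \<star> \<partial> N (\<partial> q (grn_count Max r K))) Q"
      using last_count_Min_split[of s r q N Q K m] insert.prems(1) q Q by simp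
    then show ?case
      by (simp add: set_conv_insert[OF insert.hyps(1) q(1)] set_conv_commute[of "\<partial> N _" "\<partial> q _"]
          set_deriv_commute[of q N] insert_commute)
  qed
qed

lemma last_count_least:
  assumes "s \<le> r" "finite Y" "Y \<noteq> {}" "Y \<subseteq> {r<..}"
  shows "last_count s K r (insert r Y) = 0"
  using assms(2-4)
proof (cases rule: insert_Max_cases)
  case (insert N S)
  have "(num_last r \<star> \<partial> N (grn_count Max r K)) S = 0"
    using insert(2) by (intro set_conv_eq_0) (auto intro!: end_count_notin)
  then show ?thesis using last_count_rec[OF assms(1) insert(1,2), of r K] insert by simp
qed

lemma split_list_at_Min:
  fixes w :: "'a::linorder list"
  assumes "w \<noteq> []" "distinct w"
  obtains v r v' where "w = v @ r # v'" "\<And>a. a \<in> set (v @ v') \<Longrightarrow> r < a"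
proof -
  have "Min (set w) \<in> set w" using assms(1) by simp
  then obtain v v' where w: "w = v @ Min (set w) # v'" by (meson split_list)
  have "Min (set w) < a" if "a \<in> set (v @ v')" for a
  proof -
    have "a \<in> set w" using that by (subst w) auto
    moreover have "a \<noteq> Min (set w)"
    proof
      assume "a = Min (set w)"
      then have "\<not> distinct (v @ Min (set w) # v')" using that by auto
      then show False using assms(2) w by metis
    qed
    ultimately show ?thesis by (simp add: order.not_eq_order_implies_strict)
  qed
  then show ?thesis using w that by blast
qed

lemma andre_by_Min_snoc:
  assumes "distinct u" "\<And>a. a \<in> set u \<Longrightarrow> a < N"
  shows "andre_by Min (u @ [N]) \<longleftrightarrow> andre_by Min u"
  using assms
proof (induction u rule: measure_induct_rule[where f = length])
  case (less u)
  note distinct = less.prems(1) and below = less.prems(2)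
  show ?case
  proof (cases "u = []")
    case False
    then obtain v r v' where u: "u = v @ r # v'" and above: "\<And>a. a \<in> set (v @ v') \<Longrightarrow> r < a"
      using split_list_at_Min distinct by blast
    show ?thesis
    proof (cases "v @ v' = []")
      case True
      then show ?thesis
        using below andre_by.split[of "[]" r "[N]" Min] unfolding u
        by (auto intro: andre_by.Nil andre_by.single)
    next
      case False
      have "andre_by Min (u @ [N]) \<longleftrightarrow> andre_by Min v \<and> andre_by Min (v' @ [N]) \<and>
          Min (set (v @ v' @ [N])) \<in> set (v' @ [N])"
        using andre_by_append_Cons_iff[of v r "v' @ [N]" Min] above below distinct
        unfolding u by fastforce
      also have "andre_by Min (v' @ [N]) \<longleftrightarrow> andre_by Min v'"
        using less.IH[of v'] distinct below unfolding u by simp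
      also have "Min (set (v @ v' @ [N])) \<in> set (v' @ [N]) \<longleftrightarrow> Min (set (v @ v')) \<in> set v'"
      proof -
        have "Min (set (v @ v')) < N"
          using below False Min_in[of "set (v @ v')"] unfolding u by auto
        then show ?thesis using False Min_insert[of "set (v @ v')" N] by auto
      qed
      also have "andre_by Min v \<and> andre_by Min v' \<and> Min (set (v @ v')) \<in> set v' \<longleftrightarrow> andre_by Min u"
        unfolding u using distinct above False
        by (intro andre_by_append_Cons_iff[symmetric]) (auto simp: u)
      finally show ?thesis .
    qed
  qed (auto intro: andre_by.intros)
qed

lemma snoc_in_andre_words_Min_iff:
  assumes "Y \<subseteq> {..<N}"
  shows "u @ [N] \<in> andre_words Min (insert N Y) \<longleftrightarrow> u \<in> andre_words Min Y"
proof -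
  have "N \<notin> Y" using assms by auto
  then have "set (u @ [N]) = insert N Y \<and> distinct (u @ [N]) \<longleftrightarrow> set u = Y \<and> distinct u"
    by (auto simp: insert_ident)
  moreover have "andre_by Min (u @ [N]) \<longleftrightarrow> andre_by Min u" if "set u = Y" "distinct u"
    using that assms by (intro andre_by_Min_snoc) auto
  ultimately show ?thesis unfolding andre_words_def mem_Collect_eq by metis
qed

lemma last_count_greatest:
  assumes "Y \<subseteq> {s..<N}"
  shows "last_count s K N (insert N Y) = andre_count Min (\<lambda>u. last (s # u) \<in> K) Y"
proof -
  have "Y \<subseteq> {..<N}" using assms by auto
  note snoc = snoc_in_andre_words_Min_iff[OF this]
  have grn: "bordered_grn s (u @ [N]) = last (s # u)" if "u \<in> andre_words Min Y" for u
    using that assms by (intro bordered_grn_snoc_Max) (auto simp: andre_words_def)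
  have "{w \<in> andre_words Min (insert N Y). w \<noteq> [] \<and> last w = N \<and> bordered_grn s w \<in> K} =
      (\<lambda>u. u @ [N]) ` {u \<in> andre_words Min Y. last (s # u) \<in> K}" (is "?ending = ?snocs")
  proof (intro equalityI subsetI)
    fix w assume w: "w \<in> ?ending"
    then have "w = butlast w @ [N]" using append_butlast_last_id[of w] by auto
    then obtain u where u: "w = u @ [N]" ..
    then have "u \<in> andre_words Min Y" using w snoc by simp
    then show "w \<in> ?snocs" using w u grn by simp
  qed (use snoc grn in auto)
  moreover have "card ?snocs = card {u \<in> andre_words Min Y. last (s # u) \<in> K}"
    by (rule card_image) (simp add: inj_on_def)
  ultimately show ?thesis by (simp only: end_count_def andre_count_def)
qed

lemma last_count_greatest_singleton:
  assumes "Y \<noteq> {}" "Y \<subseteq> {s..<N}"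
  shows "last_count s {k} N (insert N Y) = num_last k Y"
proof -
  have "andre_count Min (\<lambda>u. last (s # u) \<in> {k}) Y = num_last k Y"
    unfolding end_count_def using assms(1) by (intro andre_count_cong) auto
  then show ?thesis using last_count_greatest[OF assms(2)] by simp
qed

lemma num_last_greatest:
  assumes "Y \<subseteq> {..<N}"
  shows "num_last N (insert N Y) = num_words Max Y"
proof -
  have "finite Y" using finite_subset[OF assms] by simp
  then have "num_words Min Y = num_words Max Y" by (rule grn_count_Min_eq_Max) simp
  moreover have "num_last N (insert N Y) = num_words Min Y"
    using last_count_greatest[of Y 0 N UNIV] assms by (simp add: grn_count_def atLeast0LessThan)
  ultimately show ?thesis by simp
qed

lemma num_last_Min_split:
  assumes "finite Q" "r < q" "Q \<subseteq> {q<..}"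
  shows "num_last k (insert r (insert q Q)) = (num_words Max \<star> \<partial> q (num_last k)) Q"
proof -
  have "num_last k (insert r (insert q Q)) = (num_words Min \<star> \<partial> q (num_last k)) Q"
    unfolding grn_count_def end_count_def
  proof (rule andre_count_split)
    show "Min (insert q Q) = q" using assms by (intro Min_eqI) (auto intro: less_imp_le)
    show "(v @ r # v' \<noteq> [] \<and> last (v @ r # v') = k \<and> bordered_grn 0 (v @ r # v') \<in> UNIV) \<longleftrightarrow>
        bordered_grn 0 v \<in> UNIV \<and> v' \<noteq> [] \<and> last v' = k \<and> bordered_grn 0 v' \<in> UNIV"
      if "set v' = insert q (Q - set v)" for v v'
      using that by auto
  qed (use assms in auto)
  also have "\<dots> = (num_words Max \<star> \<partial> q (num_last k)) Q"
    using assms(1) by (intro set_conv_cong grn_count_Min_eq_Max) (auto intro: finite_subset)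
  finally show ?thesis .
qed

text \<open>The same rotation, applied to the path from the root to the leaf \<open>z\<close> below \<open>k\<close>.\<close>

lemma num_last_eq_grn_count:
  assumes "r < z" "S \<subseteq> {r<..<z}"
  shows "num_last k (insert r S) = grn_count Max r {k} (insert z S)"
proof -
  have "finite S" using finite_subset[OF assms(2)] by simp
  then show ?thesis
    using assms
  proof (induction arbitrary: r rule: finite_Min_subset_induct)
    case empty
    then show ?case by (simp add: end_count_singleton)
  next
    case (insert q Q)
    have q: "r < q" "q < z" and Q: "Q \<subseteq> {q<..<z}" using insert.hyps insert.prems by auto
    have "num_last k (insert r (insert q Q)) = (num_words Max \<star> \<partial> q (num_last k)) Q"
      using insert.hyps q by (intro num_last_Min_split) auto
    also have "\<dots> = (num_words Max \<star> \<partial> z (grn_count Max q {k})) Q"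
      using insert.IH q Q by (intro set_conv_cong) (auto simp: set_deriv_def)
    also have "\<dots> = grn_count Max r {k} (insert q (insert z Q))"
      using q Q by (intro grn_count_rec[symmetric]) auto
    finally show ?case by (simp add: insert_commute)
  qed
qed

lemma first_count_second_greatest:
  assumes "s \<le> r" "r < x" "x < y" "T \<subseteq> {r<..<x}"
  shows "first_count s K x (insert r (insert y (insert x T))) = grn_count Max r K (insert y T)"
proof -
  have T: "finite T" "x \<notin> T" using finite_subset[OF assms(4)] assms(4) by auto
  have "first_count s K x (insert r (insert y (insert x T))) =
      (num_first x \<star> \<partial> y (grn_count Max r K)) (insert x T)"
    using assms by (intro first_count_rec) auto
  also have "\<dots> = (\<partial> x (num_first x) \<star> \<partial> y (grn_count Max r K)) T"
    using T by (intro set_conv_insert_left) (auto intro!: end_count_notin)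
  also have "\<dots> = \<partial> x (num_first x) {} * \<partial> y (grn_count Max r K) T"
    using T(1)
  proof (rule set_conv_concentrated_left)
    fix A assume "A \<subseteq> T" "A \<noteq> {}"
    then show "\<partial> x (num_first x) A = 0"
      unfolding set_deriv_def using assms(4) by (intro num_first_greatest) auto
  qed
  finally show ?thesis by (simp add: set_deriv_def end_count_singleton)
qed

lemma last_count_second_greatest:
  assumes "s \<le> r" "r < x" "x < y" "T \<subseteq> {r<..<x}" and "x \<in> K \<longleftrightarrow> y \<in> K"
  shows "last_count s K x (insert r (insert y (insert x T))) =
    grn_count Max s K (insert r (insert x T))"
proof -
  have T: "finite T" "x \<notin> T" using finite_subset[OF assms(4)] assms(4) by auto
  have "last_count s K x (insert r (insert y (insert x T))) =
      (num_last x \<star> \<partial> y (grn_count Max r K)) (insert x T)"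
    using assms by (intro last_count_rec) auto
  also have "\<dots> = (\<partial> x (num_last x) \<star> \<partial> y (grn_count Max r K)) T"
    using T by (intro set_conv_insert_left) (auto intro!: end_count_notin)
  also have "\<dots> = (num_words Max \<star> \<partial> x (grn_count Max r K)) T"
  proof (rule set_conv_cong)
    fix A assume A: "A \<subseteq> T"
    then show "\<partial> x (num_last x) A = num_words Max A"
      unfolding set_deriv_def using assms(4) by (intro num_last_greatest) auto
    show "\<partial> y (grn_count Max r K) A = \<partial> x (grn_count Max r K) A"
      unfolding set_deriv_def
      using A assms by (intro grn_count_replace[symmetric]) auto
  qed
  also have "\<dots> = grn_count Max s K (insert r (insert x T))"
    using assms by (intro grn_count_rec[symmetric]) auto
  finally show ?thesis .
qed

subsection \<open>Exchanging consecutive letters\<close>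

definition exchange_rule :: "nat \<Rightarrow> nat set \<Rightarrow> nat \<Rightarrow> nat \<Rightarrow> nat set \<Rightarrow> bool" where
  "exchange_rule s K x y Z \<longleftrightarrow>
     first_count s K x (insert x (insert y Z)) =
       first_count s K y (insert x (insert y Z)) + last_count s K x (insert x Z) \<and>
     last_count s K y (insert x (insert y Z)) =
       last_count s K x (insert x (insert y Z)) + first_count s K x (insert x Z)"

lemma first_count_least_pair:
  assumes "s \<le> x" "x < y" "y < N" "S \<subseteq> {y<..<N}" and "x \<in> K \<longleftrightarrow> y \<in> K"
  shows "first_count s K x (insert x (insert y (insert N S))) =
    first_count s K y (insert x (insert y (insert N S)))"
proof -
  have S: "finite S" "y \<notin> S" using finite_subset[OF assms(4)] assms(4) by auto
  have "first_count s K y (insert x (insert N (insert y S))) =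
      (num_first y \<star> \<partial> N (grn_count Max x K)) (insert y S)"
    using assms by (intro first_count_rec) auto
  also have "\<dots> = (\<partial> y (num_first y) \<star> \<partial> N (grn_count Max x K)) S"
    using S by (intro set_conv_insert_left) (auto intro!: end_count_notin)
  also have "\<dots> = (num_words Max \<star> \<partial> N (grn_count Max y K)) S"
  proof (rule set_conv_cong)
    fix A assume A: "A \<subseteq> S"
    then show "\<partial> y (num_first y) A = num_words Max A"
      unfolding set_deriv_def
      using assms(4) S(1) by (intro num_first_least) (auto intro: finite_subset)
    show "\<partial> N (grn_count Max x K) A = \<partial> N (grn_count Max y K) A"
      unfolding set_deriv_def
      using A assms by (intro grn_count_replace_border) auto
  qed
  also have "\<dots> = grn_count Max x K (insert y (insert N S))"
    using assms by (intro grn_count_rec[symmetric]) auto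
  also have "\<dots> = first_count s K x (insert x (insert y (insert N S)))"
    using assms S(1) by (intro first_count_least[symmetric]) auto
  finally show ?thesis by (simp add: insert_commute)
qed

lemma last_count_least_pair:
  assumes "s \<le> x" "x < y" "y < N" "S \<subseteq> {y<..<N}"
  shows "last_count s K y (insert x (insert y (insert N S))) =
    first_count s K x (insert x (insert N S))"
proof -
  have S: "finite S" "y \<notin> S" using finite_subset[OF assms(4)] assms(4) by auto
  have "last_count s K y (insert x (insert N (insert y S))) =
      (num_last y \<star> \<partial> N (grn_count Max x K)) (insert y S)"
    using assms by (intro last_count_rec) auto
  also have "\<dots> = (\<partial> y (num_last y) \<star> \<partial> N (grn_count Max x K)) S"
    using S by (intro set_conv_insert_left) (auto intro!: end_count_notin)
  also have "\<dots> = \<partial> y (num_last y) {} * \<partial> N (grn_count Max x K) S"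
    using S(1)
  proof (rule set_conv_concentrated_left)
    fix A assume "A \<subseteq> S" "A \<noteq> {}"
    then show "\<partial> y (num_last y) A = 0"
      unfolding set_deriv_def
      using assms(4) S(1) by (intro last_count_least) (auto intro: finite_subset)
  qed
  also have "\<dots> = first_count s K x (insert x (insert N S))"
  proof -
    have "first_count s K x (insert x (insert N S)) = grn_count Max x K (insert N S)"
      using assms S(1) by (intro first_count_least) auto
    then show ?thesis by (simp add: set_deriv_def end_count_singleton)
  qed
  finally show ?thesis by (simp add: insert_commute)
qed

lemma exchange_rule_least:
  assumes "s \<le> x" "x < y" "y < N" "S \<subseteq> {y<..<N}" and "x \<in> K \<longleftrightarrow> y \<in> K"
  shows "exchange_rule s K x y (insert N S)"
proof -
  have S: "finite S" using finite_subset[OF assms(4)] by simp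
  have "last_count s K x (insert x (insert N S)) = 0"
    "last_count s K x (insert x (insert y (insert N S))) = 0"
    using assms S by (auto intro!: last_count_least)
  then show ?thesis
    unfolding exchange_rule_def
    using first_count_least_pair[OF assms] last_count_least_pair[OF assms(1-4)] by simp
qed

lemma end_count_conv_exchange:
  assumes "r < x" "x < y" "y < N" "S \<subseteq> {r<..<N} - {x..y}" and K: "x \<in> K \<longleftrightarrow> y \<in> K"
    and sel: "sel \<in> {Max, Min}" "pick \<in> {hd, last}" and ab: "{a, b} = {x, y}"
    and both: "\<And>A. A \<subseteq> S \<Longrightarrow> end_count sel pick 0 UNIV a (insert x (insert y A)) =
                 end_count sel pick 0 UNIV b (insert x (insert y A)) + d A"
  shows "(end_count sel pick 0 UNIV a \<star> \<partial> N (grn_count Max r K)) (insert x (insert y S)) =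
    (end_count sel pick 0 UNIV b \<star> \<partial> N (grn_count Max r K)) (insert x (insert y S)) +
    (d \<star> \<partial> N (grn_count Max r K)) S"
proof -
  have S: "finite S" "a \<notin> S" "b \<notin> S" "a \<noteq> b" "S \<inter> {x..y} = {}"
    using finite_subset[OF assms(4)] assms(2,4) ab by (auto simp: doubleton_eq_iff)
  have sets: "insert x (insert y A) = insert a (insert b A)" for A
    using ab by (auto simp: doubleton_eq_iff)
  show ?thesis
    unfolding sets using S(1-4)
  proof (rule set_conv_exchange)
    fix A assume A: "A \<subseteq> S"
    have "end_count sel pick 0 UNIV x (insert x A) = end_count sel pick 0 UNIV y (insert y A)"
      using A assms(1,2) sel S(5) by (intro end_count_replace) auto
    then show "\<partial> a (end_count sel pick 0 UNIV a) A = \<partial> b (end_count sel pick 0 UNIV b) A"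
      using ab by (auto simp: set_deriv_def doubleton_eq_iff)
    have "grn_count Max r K (insert x (insert N A)) = grn_count Max r K (insert y (insert N A))"
      using A assms(1-3) K S(5) by (intro grn_count_replace) auto
    then show "\<partial> a (\<partial> N (grn_count Max r K)) A = \<partial> b (\<partial> N (grn_count Max r K)) A"
      using ab by (auto simp: set_deriv_def doubleton_eq_iff insert_commute)
  qed (use S sel both sets in \<open>auto intro!: end_count_notin\<close>)
qed

lemma exchange_rule_middle:
  assumes "s \<le> r" "r < x" "x < y" "y < N" "S \<subseteq> {r<..<N} - {x..y}" and K: "x \<in> K \<longleftrightarrow> y \<in> K"
    and IH: "\<And>A. A \<subseteq> S \<Longrightarrow> exchange_rule 0 UNIV x y A"
  shows "exchange_rule s K x y (insert r (insert N S))"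
proof -
  define h where "h = \<partial> N (grn_count Max r K)"
  have S: "finite S" "x \<notin> S" using finite_subset[OF assms(5)] assms(3,5) by auto
  have first: "first_count s K m (insert r (insert N T)) = (num_first m \<star> h) T"
    and last: "last_count s K m (insert r (insert N T)) = (num_last m \<star> h) T"
    if "m \<in> {x, y}" "T \<subseteq> {r<..<N}" for m T
    unfolding h_def using that assms by (auto intro!: first_count_rec last_count_rec)
  have T: "insert x (insert y S) \<subseteq> {r<..<N}" "insert x S \<subseteq> {r<..<N}"
    using assms(2-5) by auto
  have "(num_first x \<star> h) (insert x (insert y S)) =
      (num_first y \<star> h) (insert x (insert y S)) + (\<partial> x (num_last x) \<star> h) S"
    unfolding h_def using assms(2-6) IH
    by (intro end_count_conv_exchange) (auto simp: exchange_rule_def set_deriv_def)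
  moreover have "(num_last y \<star> h) (insert x (insert y S)) =
      (num_last x \<star> h) (insert x (insert y S)) + (\<partial> x (num_first x) \<star> h) S"
    unfolding h_def using assms(2-6) IH
    by (intro end_count_conv_exchange) (auto simp: exchange_rule_def set_deriv_def)
  moreover have "(num_last x \<star> h) (insert x S) = (\<partial> x (num_last x) \<star> h) S"
    "(num_first x \<star> h) (insert x S) = (\<partial> x (num_first x) \<star> h) S"
    using S by (auto intro!: set_conv_insert_left end_count_notin)
  moreover have "insert x (insert y (insert r (insert N S))) =
      insert r (insert N (insert x (insert y S)))"
    "insert x (insert r (insert N S)) = insert r (insert N (insert x S))"
    by auto
  ultimately show ?thesis
    unfolding exchange_rule_def using T by (simp add: first last)
qed

lemma exchange_rule_greatest:
  assumes "x < y" "r < x" "S \<subseteq> {r<..<x}"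
  shows "exchange_rule 0 UNIV x y (insert r S)"
proof -
  have S: "finite S" using finite_subset[OF assms(3)] by simp
  have sets: "insert x (insert y (insert r S)) = insert r (insert y (insert x S))"
    "insert x (insert r S) = insert r (insert x S)" by auto
  have "num_first x (insert r (insert y (insert x S))) = num_words Max (insert y S)"
    using first_count_second_greatest[of 0 r x y S UNIV] assms
    by (simp add: grn_count_UNIV[of Max r])
  also have "\<dots> = num_words Max (insert r S)"
    using S assms by (intro num_words_eq_if_card_eq) (auto simp: card_insert_if)
  also have "\<dots> = num_last x (insert x (insert r S))"
    using assms by (intro num_last_greatest[symmetric]) auto
  finally have "num_first x (insert x (insert y (insert r S))) = num_last x (insert x (insert r S))"
    unfolding sets .
  moreover have "num_last x (insert x (insert y (insert r S))) =
      num_words Max (insert x (insert r S))"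
    unfolding sets using assms by (intro last_count_second_greatest) auto
  moreover have "num_last y (insert y (insert x (insert r S))) =
      num_words Max (insert x (insert r S))"
    using assms by (intro num_last_greatest) auto
  moreover have "num_first y (insert y (insert x (insert r S))) = 0"
    "num_first x (insert x (insert r S)) = 0"
    using assms by (auto intro!: num_first_greatest)
  ultimately show ?thesis
    unfolding exchange_rule_def by (simp add: insert_commute[of y x])
qed

lemma exchange_rule_empty:
  assumes "x < y"
  shows "exchange_rule 0 UNIV x y {}"
proof -
  have "num_first x {x, y} = 1" "num_last y {y, x} = 1"
    using assms num_first_least[of "{y}" x] num_last_greatest[of "{x}" y] by auto
  moreover have "num_first y {y, x} = 0" "num_last x {x, y} = 0"
    using assms num_first_greatest[of "{x}" y] last_count_least[of 0 x "{y}" UNIV] by auto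
  ultimately show ?thesis
    by (simp add: exchange_rule_def insert_commute[of y x] end_count_singleton)
qed

lemma gap_cases [consumes 3, case_names empty below above around]:
  fixes x y :: nat
  assumes "finite Z" "Z \<inter> {x..y} = {}" "x < y"
  obtains "Z = {}"
  | r S where "r < x" "S \<subseteq> {r<..<x}" "Z = insert r S"
  | N S where "y < N" "S \<subseteq> {y<..<N}" "Z = insert N S"
  | r N S where "r < x" "y < N" "S \<subseteq> {r<..<N} - {x..y}" "Z = insert r (insert N S)"
proof (cases "Z = {}")
  case False
  define r where "r = Min Z"
  define N where "N = Max Z"
  have r: "r \<in> Z" "\<And>a. a \<in> Z \<Longrightarrow> r \<le> a" and N: "N \<in> Z" "\<And>a. a \<in> Z \<Longrightarrow> a \<le> N"
    using assms(1) False by (simp_all add: r_def N_def)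
  have outside: "a < x \<or> y < a" if "a \<in> Z" for a using that assms(2) by force
  consider (below) "N < x" | (above) "y < r" | (around) "r < x" "y < N"
    using outside[OF r(1)] outside[OF N(1)] by blast
  then show ?thesis
  proof cases
    case below
    have "Z - {r} \<subseteq> {r<..<x}" using below r(2) N(2) by (fastforce simp: order.strict_iff_order)
    then show ?thesis using that(2)[of r "Z - {r}"] below r(1) N(2)[OF r(1)] by auto
  next
    case above
    have "Z - {N} \<subseteq> {y<..<N}" using above r(2) N(2) by (fastforce simp: order.strict_iff_order)
    then show ?thesis using that(3)[of N "Z - {N}"] above N(1) r(2)[OF N(1)] by auto
  next
    case around
    have "Z - {r, N} \<subseteq> {r<..<N} - {x..y}"
      using r(2) N(2) assms(2) by (fastforce simp: order.strict_iff_order)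
    then show ?thesis using that(4)[of r N "Z - {r, N}"] around r(1) N(1) by auto
  qed
qed (use that in blast)

lemma exchange_rule_step:
  assumes Z: "finite Z" "Z \<inter> {x..y} = {}" "x < y" and z: "\<exists>z\<in>Z. y < z"
    and s: "s \<le> x" "\<And>a. a \<in> Z \<Longrightarrow> s \<le> a" and K: "x \<in> K \<longleftrightarrow> y \<in> K"
    and IH: "\<And>A. A \<subset> Z \<Longrightarrow> exchange_rule 0 UNIV x y A"
  shows "exchange_rule s K x y Z"
  using Z
proof (cases rule: gap_cases)
  case (above N S)
  then show ?thesis using \<open>x < y\<close> s(1) K by (simp add: exchange_rule_least)
next
  case (around r N S)
  have "exchange_rule 0 UNIV x y A" if "A \<subseteq> S" for A
  proof (rule IH)
    have "r \<notin> A" "A \<subseteq> Z" using that around by auto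
    then show "A \<subset> Z" using around(4) by auto
  qed
  then show ?thesis
    unfolding around(4) using around \<open>x < y\<close> s(2)[of r] K by (intro exchange_rule_middle) auto
qed (use z \<open>x < y\<close> in auto)

lemma exchange_rule_UNIV:
  assumes "finite Z" "Z \<inter> {x..y} = {}" "x < y"
  shows "exchange_rule 0 UNIV x y Z"
  using assms
proof (induction rule: finite_psubset_induct)
  case (psubset Z)
  have IH: "exchange_rule 0 UNIV x y A" if "A \<subset> Z" for A
    using that psubset.prems by (intro psubset.IH) auto
  show ?case
  proof (cases "\<exists>z\<in>Z. y < z")
    case True
    show ?thesis
      using psubset.hyps psubset.prems True by (rule exchange_rule_step) (simp_all add: IH)
  next
    case False
    show ?thesis
      using psubset.hyps psubset.prems
    proof (cases rule: gap_cases)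
      case empty
      then show ?thesis using \<open>x < y\<close> by (simp add: exchange_rule_empty)
    next
      case (below r S)
      then show ?thesis using \<open>x < y\<close> by (simp add: exchange_rule_greatest)
    qed (use False in auto)
  qed
qed

lemma exchange_rule_if_not_greatest:
  assumes "finite Z" "Z \<inter> {x..y} = {}" "x < y" and "\<exists>z\<in>Z. y < z"
    and "s \<le> x" "\<And>a. a \<in> Z \<Longrightarrow> s \<le> a" and "x \<in> K \<longleftrightarrow> y \<in> K"
  shows "exchange_rule s K x y Z"
  using assms
proof (rule exchange_rule_step)
  fix A assume "A \<subset> Z"
  then show "exchange_rule 0 UNIV x y A"
    using assms(1-3) by (intro exchange_rule_UNIV) (auto intro: finite_subset)
qed

subsection \<open>Twin Seidel sequences are unique\<close>

lemma eq_iff_eq_if_differences_eq: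
  fixes f g :: "nat \<Rightarrow> nat"
  assumes "i \<le> j"
    and "\<And>l. i \<le> l \<Longrightarrow> l < j \<Longrightarrow> int (f (l + 1)) - int (f l) = int (g (l + 1)) - int (g l)"
  shows "f i = g i \<longleftrightarrow> f j = g j"
  using assms
proof (induction j rule: dec_induct)
  case (step j)
  have "f (j + 1) = g (j + 1) \<longleftrightarrow> f j = g j" using step.prems[of j] step.hyps by auto
  then show ?case using step by simp
qed simp

lemma TS2D:
  assumes "TS2 a b" "n \<ge> 3" "m \<in> {1..n}"
  shows "a n m n = 0" "b n m n = 0" "a n n m = 0" "b n 1 m = 0" "b n n 1 = 0"
  using assms unfolding TS2_def by auto

lemma TS4D:
  assumes "TS4 a b" "n \<ge> 3"
  shows "2 \<le> k \<Longrightarrow> k < n \<Longrightarrow> b n n k = col_sum a (n - 1) (k - 1)"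
    and "1 \<le> k \<Longrightarrow> k + 1 < n \<Longrightarrow> b n (n - 1) k = col_sum a (n - 1) k"
    and "1 \<le> k \<Longrightarrow> k < m \<Longrightarrow> m + 1 < n \<Longrightarrow>
      int (b n (m + 1) k) - int (b n m k) = int (a (n - 1) m k)"
    and "1 \<le> m \<Longrightarrow> m + 2 \<le> k \<Longrightarrow> k < n \<Longrightarrow>
      int (b n (m + 1) k) - int (b n m k) = int (a (n - 1) m (k - 1))"
  using assms(1)[unfolded TS4_def, rule_format, OF assms(2)] by auto

lemma TS5D:
  assumes "TS5 a b" "n \<ge> 3"
  shows "2 \<le> k \<Longrightarrow> k < n \<Longrightarrow> a n 1 k = col_sum b (n - 1) (k - 1)"
    and "1 \<le> m \<Longrightarrow> m + 2 \<le> k \<Longrightarrow> k < n \<Longrightarrow>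
      int (a n (m + 1) k) - int (a n m k) = - int (b (n - 1) m (k - 1))"
    and "1 \<le> k \<Longrightarrow> k < m \<Longrightarrow> m < n \<Longrightarrow>
      int (a n (m + 1) k) - int (a n m k) = - int (b (n - 1) m k)"
  using assms(1)[unfolded TS5_def, rule_format, OF assms(2)] by auto

lemma col_sum_cong:
  assumes "\<And>m. m \<in> {1..n} \<Longrightarrow> a n m k = a' n m k"
  shows "col_sum a n k = col_sum a' n k"
  unfolding col_sum_def using assms by (intro sum.cong) auto

context
  fixes a b a' b' :: matrix_seq and n :: nat
  assumes twin: "twin_seidel a b" "twin_seidel a' b'" and n: "n \<ge> 3"
begin

lemma twin_seidel_last_column_and_diagonal:
  assumes "m \<in> {1..n}" "k = n \<or> m = k"
  shows "a n m k = a' n m k \<and> b n m k = b' n m k"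
  using assms(2)
proof
  assume "k = n"
  have TS2: "TS2 a b" "TS2 a' b'" using twin by (simp_all add: twin_seidel_def)
  show ?thesis using TS2D[OF TS2(1) n assms(1)] TS2D[OF TS2(2) n assms(1)] \<open>k = n\<close> by simp
next
  assume "m = k"
  have "TS1 a b" "TS1 a' b'" using twin by (simp_all add: twin_seidel_def)
  then show ?thesis using assms(1) n \<open>m = k\<close> unfolding TS1_def by auto
qed

lemma twin_seidel_a_determined:
  assumes b: "\<And>m k. 1 \<le> m \<Longrightarrow> m < n \<Longrightarrow> 1 \<le> k \<Longrightarrow> k < n \<Longrightarrow>
                b (n - 1) m k = b' (n - 1) m k"
    and mk: "m \<in> {1..n}" "k \<in> {1..n}"
  shows "a n m k = a' n m k"
proof -
  have TS: "TS2 a b" "TS2 a' b'" "TS5 a b" "TS5 a' b'" using twin by (simp_all add: twin_seidel_def)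
  consider (boundary) "k = n \<or> m = k" | (above) "m < k" "k < n" | (below) "k < m"
    using mk by fastforce
  then show ?thesis
  proof cases
    case boundary
    then show ?thesis using twin_seidel_last_column_and_diagonal mk(1) by simp
  next
    case above
    then have k: "1 \<le> k - 1" "k - 1 < n" using mk by auto
    then have "col_sum b (n - 1) (k - 1) = col_sum b' (n - 1) (k - 1)"
      by (intro col_sum_cong b) auto
    then have "a n 1 k = a' n 1 k"
      using above mk TS5D(1)[OF TS(3) n, of k] TS5D(1)[OF TS(4) n, of k] by simp
    moreover have "a n 1 k = a' n 1 k \<longleftrightarrow> a n m k = a' n m k"
    proof (rule eq_iff_eq_if_differences_eq)
      fix l assume "1 \<le> l" "l < m"
      then show "int (a n (l + 1) k) - int (a n l k) = int (a' n (l + 1) k) - int (a' n l k)"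
        using above k TS5D(2)[OF TS(3) n, of l k] TS5D(2)[OF TS(4) n, of l k] b[of l "k - 1"]
        by simp
    qed (use mk in simp)
    ultimately show ?thesis by simp
  next
    case below
    have "a n n k = a' n n k" using TS2D[OF TS(1) n] TS2D[OF TS(2) n] mk by simp
    moreover have "a n m k = a' n m k \<longleftrightarrow> a n n k = a' n n k"
    proof (rule eq_iff_eq_if_differences_eq)
      fix l assume "m \<le> l" "l < n"
      then show "int (a n (l + 1) k) - int (a n l k) = int (a' n (l + 1) k) - int (a' n l k)"
        using below mk TS5D(3)[OF TS(3) n, of k l] TS5D(3)[OF TS(4) n, of k l] b[of l k] by simp
    qed (use mk in simp)
    ultimately show ?thesis by simp
  qed
qed

lemma twin_seidel_b_determined:
  assumes a: "\<And>m k. 1 \<le> m \<Longrightarrow> m < n \<Longrightarrow> 1 \<le> k \<Longrightarrow> k < n \<Longrightarrow>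
                a (n - 1) m k = a' (n - 1) m k"
    and mk: "m \<in> {1..n}" "k \<in> {1..n}"
  shows "b n m k = b' n m k"
proof -
  have TS: "TS2 a b" "TS2 a' b'" "TS4 a b" "TS4 a' b'" using twin by (simp_all add: twin_seidel_def)
  have col_sum: "col_sum a (n - 1) l = col_sum a' (n - 1) l" if "1 \<le> l" "l < n" for l
    using that by (intro col_sum_cong a) auto
  consider (boundary) "k = n \<or> m = k" | (above) "m < k" "k < n" | (below) "k < m" "m < n"
    | (corner) "k = 1" "m = n" | (last_row) "1 < k" "k < m" "m = n"
    using mk by fastforce
  then show ?thesis
  proof cases
    case boundary
    then show ?thesis using twin_seidel_last_column_and_diagonal mk(1) by simp
  next
    case above
    then have k: "1 \<le> k - 1" "k - 1 < n" using mk by auto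
    have "b n 1 k = b' n 1 k" using TS2D[OF TS(1) n] TS2D[OF TS(2) n] mk by simp
    moreover have "b n 1 k = b' n 1 k \<longleftrightarrow> b n m k = b' n m k"
    proof (rule eq_iff_eq_if_differences_eq)
      fix l assume "1 \<le> l" "l < m"
      then show "int (b n (l + 1) k) - int (b n l k) = int (b' n (l + 1) k) - int (b' n l k)"
        using above k TS4D(4)[OF TS(3) n, of l k] TS4D(4)[OF TS(4) n, of l k] a[of l "k - 1"]
        by simp
    qed (use mk in simp)
    ultimately show ?thesis by simp
  next
    case below
    have "b n (n - 1) k = b' n (n - 1) k"
      using below mk TS4D(2)[OF TS(3) n, of k] TS4D(2)[OF TS(4) n, of k] col_sum[of k] by simp
    moreover have "b n m k = b' n m k \<longleftrightarrow> b n (n - 1) k = b' n (n - 1) k"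
    proof (rule eq_iff_eq_if_differences_eq)
      fix l assume "m \<le> l" "l < n - 1"
      then show "int (b n (l + 1) k) - int (b n l k) = int (b' n (l + 1) k) - int (b' n l k)"
        using below mk TS4D(3)[OF TS(3) n, of k l] TS4D(3)[OF TS(4) n, of k l] a[of l k] by simp
    qed (use below in simp)
    ultimately show ?thesis by simp
  next
    case corner
    then show ?thesis using TS2D(5)[OF TS(1) n mk(1)] TS2D(5)[OF TS(2) n mk(1)] by simp
  next
    case last_row
    then show ?thesis
      using TS4D(1)[OF TS(3) n, of k] TS4D(1)[OF TS(4) n, of k] col_sum[of "k - 1"] by simp
  qed
qed

end

lemma twin_seidel_unique:
  assumes "twin_seidel a b" "twin_seidel a' b'" "n \<ge> 2"
  shows "\<forall>m\<in>{1..n}. \<forall>k\<in>{1..n}. a n m k = a' n m k \<and> b n m k = b' n m k"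
  using \<open>n \<ge> 2\<close>
proof (induction n rule: dec_induct)
  case base
  have "{1..2} = {1, 2 :: nat}" by auto
  then show ?case using assms(1,2) unfolding twin_seidel_def TS3_def by simp
next
  case (step n)
  then have "Suc n \<ge> 3" by simp
  then show ?case
    using twin_seidel_a_determined[OF assms(1,2), of "Suc n"]
      twin_seidel_b_determined[OF assms(1,2), of "Suc n"] step.IH by simp
qed

subsection \<open>The counts form a twin Seidel sequence\<close>

definition A_count :: matrix_seq where
  "A_count n m k = first_count 0 {k} m {1..n}"

definition B_count :: matrix_seq where
  "B_count n m k = last_count 0 {k} m {1..n}"

lemma atLeast1_atMost_eq_insert:
  assumes "n \<ge> 2"
  shows "{1..n} = insert 1 (insert n {2..n - 1 :: nat})" "{2..n - 1} \<subseteq> {1<..<n}"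
  using assms by auto

lemma grn_count_interval_shift:
  assumes "n \<ge> 2" "k \<ge> 2"
  shows "grn_count Max 1 {k} {2..n} = grn_count Max 0 {k - 1} {1..n - 1}"
proof -
  have image: "Suc ` {1..n - 1} = {2..n}"
    using assms(1) by (simp add: image_Suc_atLeastAtMost numeral_2_eq_2)
  have "grn_count Max (Suc 0) {k} (Suc ` {1..n - 1}) = grn_count Max 0 {k - 1} {1..n - 1}"
    using assms by (intro grn_count_image) (auto simp: strict_mono_on_def)
  then show ?thesis unfolding image by simp
qed

lemma col_sum_A_count: "n \<ge> 1 \<Longrightarrow> col_sum A_count n k = grn_count Max 0 {k} {1..n}"
  unfolding col_sum_def A_count_def by (rule sum_end_count) auto

lemma col_sum_B_count: "n \<ge> 1 \<Longrightarrow> col_sum B_count n k = grn_count Max 0 {k} {1..n}"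
  unfolding col_sum_def B_count_def by (simp add: sum_end_count grn_count_Min_eq_Max)

lemma A_count_first_row:
  assumes "n \<ge> 2"
  shows "A_count n 1 k = grn_count Max 1 {k} {2..n}"
proof -
  have "{1..n} = insert 1 {2..n}" using assms by auto
  then show ?thesis using assms by (auto simp: A_count_def intro!: first_count_least)
qed

lemma A_count_last_row: "n \<ge> 2 \<Longrightarrow> A_count n n k = 0"
  unfolding A_count_def atLeast1_atMost_eq_insert(1)
  by (intro first_count_greatest atLeast1_atMost_eq_insert) auto

lemma B_count_first_row:
  assumes "n \<ge> 2"
  shows "B_count n 1 k = 0"
proof -
  have "{1..n} = insert 1 {2..n}" using assms by auto
  then show ?thesis using assms by (auto simp: B_count_def intro!: last_count_least)
qed

lemma B_count_last_row:
  assumes "n \<ge> 2"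
  shows "B_count n n k = num_last k {1..n - 1}"
proof -
  have "{1..n} = insert n {1..n - 1}" using assms by auto
  then show ?thesis using assms by (auto simp: B_count_def intro!: last_count_greatest_singleton)
qed

lemma A_count_2: "A_count 2 1 k = (if k = 1 then 1 else 0)" "A_count 2 2 k = 0"
  using A_count_first_row[of 2 k] A_count_last_row[of 2 k] by simp_all

lemma B_count_2: "B_count 2 1 k = 0" "B_count 2 2 k = (if k = 1 then 1 else 0)"
  using B_count_first_row[of 2 k] B_count_last_row[of 2 k] by (simp_all add: end_count_singleton)

lemma end_count_conv_diagonal:
  assumes "S \<subseteq> {r<..<N}" "pick \<in> {hd, last}"
  shows "(end_count sel pick 0 UNIV m \<star> \<partial> N (grn_count Max r {m})) S = 0"
proof (rule set_conv_eq_0)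
  fix A assume A: "A \<subseteq> S"
  show "end_count sel pick 0 UNIV m A = 0 \<or> \<partial> N (grn_count Max r {m}) (S - A) = 0"
  proof (cases "m \<in> A")
    case True
    have "Max (insert N (S - A)) = N" using assms(1) by (intro Max_insert_above[of _ r]) auto
    then have "grn_count Max r {m} (insert N (S - A)) = 0"
      using True A assms(1) by (intro grn_count_eq_0) auto
    then show ?thesis by (simp add: set_deriv_def)
  qed (use assms(2) in \<open>simp add: end_count_notin\<close>)
qed

lemma grn_count_border_eq_0:
  assumes "s < r" "r < N" "S \<subseteq> {r<..<N}"
  shows "grn_count Max s {s} (insert r (insert N S)) = 0"
proof -
  have "\<partial> N (grn_count Max r {s}) A = 0" if "A \<subseteq> S" for A
    unfolding set_deriv_def using that assms by (intro grn_count_eq_0) auto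
  then have "(num_words Max \<star> \<partial> N (grn_count Max r {s})) S = 0"
    by (intro set_conv_eq_0) auto
  then show ?thesis using assms by (simp add: grn_count_rec)
qed

lemma A_count_diagonal:
  assumes "n \<ge> 3"
  shows "A_count n m m = 0"
proof (cases "m = 1")
  case True
  have "{2..n} = insert 2 (insert n {3..n - 1})" "{3..n - 1} \<subseteq> {2<..<n}" using assms by auto
  then have "grn_count Max 1 {1} {2..n} = 0"
    using grn_count_border_eq_0[of 1 2 n "{3..n - 1}"] assms by simp
  then show ?thesis using True A_count_first_row[of n 1] assms by simp
next
  case False
  then have "A_count n m m = (num_first m \<star> \<partial> n (grn_count Max 1 {m})) {2..n - 1}"
    unfolding A_count_def using assms atLeast1_atMost_eq_insert[of n]
    by (simp add: first_count_rec)
  also have "\<dots> = 0" using assms by (intro end_count_conv_diagonal) auto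
  finally show ?thesis .
qed

lemma B_count_diagonal:
  assumes "n \<ge> 2"
  shows "B_count n m m = 0"
proof (cases "m = n")
  case True
  then show ?thesis using B_count_last_row[OF assms, of m] assms by (simp add: end_count_notin)
next
  case False
  then have "B_count n m m = (num_last m \<star> \<partial> n (grn_count Max 1 {m})) {2..n - 1}"
    unfolding B_count_def using assms atLeast1_atMost_eq_insert[of n]
    by (simp add: last_count_rec)
  also have "\<dots> = 0" using assms by (intro end_count_conv_diagonal) auto
  finally show ?thesis .
qed

lemma atLeast1_atMost_eq_insert_second_greatest:
  "n \<ge> 3 \<Longrightarrow> {1..n} = insert 1 (insert n (insert (n - 1) {2..n - 2 :: nat}))"
  by auto

lemma A_count_second_last_row:
  assumes "n \<ge> 3"
  shows "A_count n (n - 1) k = B_count (n - 1) (n - 1) k"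
proof -
  have "A_count n (n - 1) k = grn_count Max 1 {k} (insert n {2..n - 2})"
    unfolding A_count_def atLeast1_atMost_eq_insert_second_greatest[OF assms] using assms
    by (intro first_count_second_greatest) auto
  also have "\<dots> = num_last k (insert 1 {2..n - 2})"
    using assms by (intro num_last_eq_grn_count[symmetric]) auto
  also have "insert 1 {2..n - 2} = {1..n - 1 - 1}" using assms by auto
  also have "num_last k \<dots> = B_count (n - 1) (n - 1) k"
    using assms by (intro B_count_last_row[symmetric]) auto
  finally show ?thesis .
qed

lemma B_count_second_last_row:
  assumes "n \<ge> 3" "k \<le> n - 2"
  shows "B_count n (n - 1) k = grn_count Max 0 {k} {1..n - 1}"
proof -
  have "B_count n (n - 1) k = grn_count Max 0 {k} (insert 1 (insert (n - 1) {2..n - 2}))"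
    unfolding B_count_def atLeast1_atMost_eq_insert_second_greatest[OF assms(1)] using assms
    by (intro last_count_second_greatest) auto
  also have "insert 1 (insert (n - 1) {2..n - 2}) = {1..n - 1}" using assms by auto
  finally show ?thesis .
qed

definition skip :: "nat \<Rightarrow> nat \<Rightarrow> nat" where
  "skip m i = (if i \<le> m then i else i + 1)"

lemma strict_mono_on_skip: "strict_mono_on X (skip m)"
  by (auto simp: strict_mono_on_def skip_def)

lemma skip_image:
  assumes "m < n"
  shows "skip m ` {1..n - 1} = {1..n} - {m + 1}"
proof (intro equalityI subsetI)
  fix i assume i: "i \<in> {1..n} - {m + 1}"
  show "i \<in> skip m ` {1..n - 1}"
  proof (cases "i \<le> m")
    case True
    then show ?thesis using i assms by (intro image_eqI[of _ _ i]) (auto simp: skip_def)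
  next
    case False
    then show ?thesis using i assms by (intro image_eqI[of _ _ "i - 1"]) (auto simp: skip_def)
  qed
qed (use assms in \<open>auto simp: skip_def\<close>)

lemma end_count_skip:
  assumes "1 \<le> m" "m < n" "sel \<in> {Max, Min}" "pick \<in> {hd, last}"
  shows "end_count sel pick 0 {skip m k} m ({1..n} - {m + 1}) =
    end_count sel pick 0 {k} m {1..n - 1}"
proof -
  have "end_count sel pick (skip m 0) {skip m k} (skip m m) (skip m ` {1..n - 1}) =
      end_count sel pick 0 {k} m {1..n - 1}"
    using assms
    by (intro end_count_image strict_mono_on_skip) (auto simp: skip_def split: if_splits)
  then show ?thesis unfolding skip_image[OF assms(2)] by (simp add: skip_def)
qed

lemma count_differences:
  assumes "1 \<le> m" "m + 1 < n" "k \<noteq> m"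
  shows "A_count n m (skip m k) = A_count n (m + 1) (skip m k) + B_count (n - 1) m k"
    and "B_count n (m + 1) (skip m k) = B_count n m (skip m k) + A_count (n - 1) m k"
proof -
  let ?Z = "{1..n} - {m, m + 1}"
  have sets: "insert m (insert (m + 1) ?Z) = {1..n}" "insert m ?Z = {1..n} - {m + 1}"
    using assms by auto
  have "exchange_rule 0 {skip m k} m (m + 1) ?Z"
  proof (rule exchange_rule_if_not_greatest)
    show "\<exists>z\<in>?Z. m + 1 < z" using assms by (intro bexI[of _ n]) auto
    show "m \<in> {skip m k} \<longleftrightarrow> m + 1 \<in> {skip m k}" using assms(3) by (auto simp: skip_def)
  qed auto
  then show "A_count n m (skip m k) = A_count n (m + 1) (skip m k) + B_count (n - 1) m k"
    "B_count n (m + 1) (skip m k) = B_count n m (skip m k) + A_count (n - 1) m k"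
    unfolding exchange_rule_def sets A_count_def B_count_def
    using assms end_count_skip[of m n Max hd k] end_count_skip[of m n Min last k] by simp_all
qed

lemma TS1_counts: "TS1 A_count B_count"
  unfolding TS1_def
proof (intro allI impI ballI)
  fix n m :: nat assume n: "n \<ge> 2" "m \<in> {1..n}"
  show "A_count n m m = (if n = 2 \<and> m = 1 then 1 else 0) \<and> B_count n m m = 0"
  proof (cases "n = 2")
    case True
    then have "m = 1 \<or> m = 2" using n by auto
    then show ?thesis using True A_count_2 B_count_2 by auto
  next
    case False
    then show ?thesis using n A_count_diagonal[of n m] B_count_diagonal[of n m] by simp
  qed
qed

lemma TS2_counts: "TS2 A_count B_count"
  unfolding TS2_def
proof (intro allI impI ballI conjI)
  fix n m :: nat assume n: "n \<ge> 3"
  have "Max {1..n} = n" using n by (intro Max_eqI) auto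
  then show "A_count n m n = 0" "B_count n m n = 0"
    using n unfolding A_count_def B_count_def by (auto intro!: end_count_eq_0)
  show "A_count n n m = 0" "B_count n 1 m = 0"
    using n A_count_last_row B_count_first_row by simp_all
  have "B_count n n 1 = num_last 1 (insert 1 {2..n - 1})"
  proof -
    have "insert 1 {2..n - 1} = {1..n - 1}" using n by auto
    then show ?thesis using B_count_last_row[of n 1] n by simp
  qed
  also have "\<dots> = 0" using n by (intro last_count_least) auto
  finally show "B_count n n 1 = 0" .
qed

lemma TS3_counts: "TS3 A_count B_count"
  unfolding TS3_def A_count_2 B_count_2 by simp

lemma TS4_counts: "TS4 A_count B_count"
  unfolding TS4_def
proof (intro allI impI conjI)
  fix n k :: nat assume n: "n \<ge> 3" and k: "2 \<le> k \<and> k \<le> n - 1"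
  have "{1..n - 1} = insert 1 {2..n - 1}" using n by auto
  then have "B_count n n k = num_last k (insert 1 {2..n - 1})"
    using B_count_last_row[of n k] n by simp
  also have "\<dots> = grn_count Max 1 {k} (insert n {2..n - 1})"
    using n by (intro num_last_eq_grn_count) auto
  also have "insert n {2..n - 1} = {2..n}" using n by auto
  also have "grn_count Max 1 {k} {2..n} = col_sum A_count (n - 1) (k - 1)"
    using grn_count_interval_shift[of n k] n k by (simp add: col_sum_A_count)
  finally show "B_count n n k = col_sum A_count (n - 1) (k - 1)" .
next
  fix n k :: nat assume "n \<ge> 3" "1 \<le> k \<and> k \<le> n - 2"
  then show "B_count n (n - 1) k = col_sum A_count (n - 1) k"
    using B_count_second_last_row[of n k] col_sum_A_count[of "n - 1" k] by simp
next
  fix n m k :: nat assume "n \<ge> 3" and mk: "2 \<le> k + 1 \<and> k + 1 \<le> m \<and> m \<le> n - 2"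
  then have "skip m k = k" "m + 1 < n" by (auto simp: skip_def)
  then show "int (B_count n (m + 1) k) - int (B_count n m k) = int (A_count (n - 1) m k)"
    using count_differences(2)[of m n k] mk by simp
next
  fix n m k :: nat assume "n \<ge> 3" and mk: "3 \<le> m + 2 \<and> m + 2 \<le> k \<and> k \<le> n - 1"
  then have "skip m (k - 1) = k" "m + 1 < n" "k - 1 \<noteq> m" by (auto simp: skip_def)
  then show "int (B_count n (m + 1) k) - int (B_count n m k) = int (A_count (n - 1) m (k - 1))"
    using count_differences(2)[of m n "k - 1"] mk by simp
qed

lemma TS5_counts: "TS5 A_count B_count"
  unfolding TS5_def
proof (intro allI impI conjI)
  fix n k :: nat assume "n \<ge> 3" "2 \<le> k \<and> k \<le> n - 1"
  then show "A_count n 1 k = col_sum B_count (n - 1) (k - 1)"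
    using A_count_first_row[of n k] grn_count_interval_shift[of n k] by (simp add: col_sum_B_count)
next
  fix n m k :: nat assume "n \<ge> 3" and mk: "3 \<le> m + 2 \<and> m + 2 \<le> k \<and> k \<le> n - 1"
  then have "skip m (k - 1) = k" "m + 1 < n" "k - 1 \<noteq> m" by (auto simp: skip_def)
  then show "int (A_count n (m + 1) k) - int (A_count n m k) = - int (B_count (n - 1) m (k - 1))"
    using count_differences(1)[of m n "k - 1"] mk by simp
next
  fix n m k :: nat assume n: "n \<ge> 3" and mk: "2 \<le> k + 1 \<and> k + 1 \<le> m \<and> m \<le> n - 1"
  then have skip: "skip m k = k" by (simp add: skip_def)
  show "int (A_count n (m + 1) k) - int (A_count n m k) = - int (B_count (n - 1) m k)"
  proof (cases "m = n - 1")
    case True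
    then show ?thesis using A_count_second_last_row[of n k] A_count_last_row[of n k] n by simp
  next
    case False
    then have "m + 1 < n" using mk by auto
    then show ?thesis using count_differences(1)[of m n k] mk skip by simp
  qed
qed

lemma twin_seidel_counts: "twin_seidel A_count B_count"
  using TS1_counts TS2_counts TS3_counts TS4_counts TS5_counts by (simp add: twin_seidel_def)

subsection \<open>The statistics of the theorem\<close>

lemma And_I_eq: "And_I n = andre_words Max {1..n}"
  unfolding And_I_def andre_words_def permutations_of_set_def andre_I_eq by auto

lemma And_II_eq: "And_II n = andre_words Min {1..n}"
  unfolding And_II_def andre_words_def permutations_of_set_def andre_II_eq by auto

lemma last_andre_by_Max: "andre_by Max w \<Longrightarrow> w \<noteq> [] \<Longrightarrow> last w = Max (set w)"
proof (induction rule: andre_by.induct)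
  case (split v x v')
  define M where "M = Max (set (v @ v'))"
  have v': "M \<in> set v'" using split.hyps(6) by (simp add: M_def)
  then have "last (v @ x # v') = Max (set v')" using split.IH(2) by auto
  also have "\<dots> = M" using v' by (intro Max_eqI) (auto simp: M_def)
  also have "\<dots> = Max (set (v @ x # v'))"
  proof (rule Max_eqI[symmetric])
    have "Min (set (v @ x # v')) \<le> M" using v' by (intro Min_le) auto
    then have "x \<le> M" using split.hyps(3) by simp
    then show "a \<le> M" if "a \<in> set (v @ x # v')" for a using that by (auto simp: M_def)
  qed (use v' in auto)
  finally show ?case .
qed auto

lemma letter_append_Cons:
  "letter (p @ x # q) (length p) = last (0 # p)"
  "letter (p @ x # q) (length p + 2) = hd (q @ [0])"
  by (cases p rule: rev_cases; auto simp: letter_def nth_append)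
     (cases q; auto simp: letter_def nth_append)

lemma F_stat_eq_hd: "w \<noteq> [] \<Longrightarrow> F_stat w = hd w"
  by (cases w) (simp_all add: F_stat_def letter_def)

lemma L_stat_eq_last: "w \<noteq> [] \<Longrightarrow> L_stat w = last w"
  by (simp add: L_stat_def letter_def last_conv_nth Suc_leI)

lemma NL_stat_eq_bordered_grn:
  assumes "andre_by Max w" "distinct w" "w \<noteq> []"
  shows "NL_stat w = bordered_grn 0 w"
proof -
  define N where "N = last w"
  define u where "u = butlast w"
  have w: "w = u @ [N]" using assms(3) by (simp add: u_def N_def)
  then have "NL_stat w = last (0 # u)"
    using letter_append_Cons(1)[of u N "[]"] by (simp add: NL_stat_def)
  moreover have "a < N" if "a \<in> set u" for a
  proof -
    have "a \<le> Max (set w)" using that w by (intro Max_ge) auto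
    then have "a \<le> N" using last_andre_by_Max[OF assms(1,3)] by (simp add: N_def)
    moreover have "a \<noteq> N" using that w assms(2) by auto
    ultimately show ?thesis by simp
  qed
  ultimately show ?thesis unfolding w by (simp add: bordered_grn_snoc_Max)
qed

lemma grn_eq_bordered_grn:
  assumes "set w = {1..n}" "distinct w" "n \<ge> 1"
  shows "grn w = bordered_grn 0 w"
proof -
  have length: "length w = n" using assms distinct_card[of w] by simp
  have "n \<in> set w" using assms by simp
  then obtain p q where w: "w = p @ n # q" "n \<notin> set p" by (meson split_list_first)
  have "(THE i. 1 \<le> i \<and> i \<le> length w \<and> letter w i = length w) = length p + 1"
  proof (rule the_equality)
    show "1 \<le> length p + 1 \<and> length p + 1 \<le> length w \<and> letter w (length p + 1) = length w"
      using length by (simp add: w(1) letter_def)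
    fix i assume i: "1 \<le> i \<and> i \<le> length w \<and> letter w i = length w"
    then have "w ! (i - 1) = w ! length p" "i - 1 < length w" "length p < length w"
      using length by (auto simp: letter_def w(1))
    then have "i - 1 = length p" using assms(2) nth_eq_iff_index_eq by blast
    then show "i = length p + 1" using conjunct1[OF i] by linarith
  qed
  then have "grn w = max (last (0 # p)) (hd (q @ [0]))"
    unfolding grn_def using letter_append_Cons[of p n q] by (simp add: w(1))
  moreover have "Max (set w) = n" unfolding assms(1) using assms(3) by (intro Max_eqI) auto
  ultimately show ?thesis using bordered_grn_at_Max[of p n q 0] w by simp
qed

lemma card_And_I_eq_A_count:
  assumes "n \<ge> 1"
  shows "card {w \<in> And_I n. (F_stat w, NL_stat w) = (m, k)} = A_count n m k"
proof -
  have "w \<noteq> [] \<and> hd w = m \<and> bordered_grn 0 w \<in> {k} \<longleftrightarrow> (F_stat w, NL_stat w) = (m, k)"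
    if "w \<in> andre_words Max {1..n}" for w
  proof -
    have w: "andre_by Max w" "distinct w" "w \<noteq> []" using that assms by (auto simp: andre_words_def)
    then show ?thesis by (simp add: F_stat_eq_hd NL_stat_eq_bordered_grn)
  qed
  then show ?thesis
    unfolding A_count_def end_count_def andre_count_def And_I_eq
    by (intro arg_cong[of _ _ card]) blast
qed

lemma card_And_II_eq_B_count:
  assumes "n \<ge> 1"
  shows "card {w \<in> And_II n. (L_stat w, grn w) = (m, k)} = B_count n m k"
proof -
  have "w \<noteq> [] \<and> last w = m \<and> bordered_grn 0 w \<in> {k} \<longleftrightarrow> (L_stat w, grn w) = (m, k)"
    if "w \<in> andre_words Min {1..n}" for w
  proof -
    have w: "set w = {1..n}" "distinct w" "w \<noteq> []" using that assms by (auto simp: andre_words_def)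
    then show ?thesis using assms by (simp add: L_stat_eq_last grn_eq_bordered_grn)
  qed
  then show ?thesis
    unfolding B_count_def end_count_def andre_count_def And_II_eq
    by (intro arg_cong[of _ _ card]) blast
qed

theorem theorem1p2:
  fixes a b :: matrix_seq and n m k :: nat
  assumes "twin_seidel a b"
    and "n \<ge> 2"
    and "1 \<le> m" and "m \<le> n"
    and "1 \<le> k" and "k \<le> n"
  shows "a n m k = card {w \<in> And_I n. (F_stat w, NL_stat w) = (m, k)}
       \<and> b n m k = card {w \<in> And_II n. (L_stat w, grn w) = (m, k)}"
proof -
  have "a n m k = A_count n m k \<and> b n m k = B_count n m k"
    using twin_seidel_unique[OF assms(1) twin_seidel_counts assms(2)] assms(3-6) by simp
  moreover have "n \<ge> 1" using assms(2) by simp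
  ultimately show ?thesis
    by (simp only: card_And_I_eq_A_count card_And_II_eq_B_count)
qed

end
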